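(* Let $f\colon I\to I$ be a piecewise monotone map. The space $\varprojlim\{I,f\}$ is an arc if and only if for every $x\in I$ there exists $y\in\mathrm{Fix}(f^2)$ such that $x$ is $f^2$-attracted to $y$, and moreover all points in any given connected component of $I\setminus\mathrm{Fix}(f^2)$ are $f^2$-attracted to the same point of $\mathrm{Fix}(f^2)$.
   Context: $I=[0,1]$. A map $f\colon I\to I$ always means a continuous surjection. A point $c\in(0,1)$ is a critical point of $f$ if for every open $J\ni c$ the restriction $f|_J$ is not one-to-one; $f$ is piecewise monotone if it has finitely many critical points. $\varprojlim\{I,f\}=\{(x_0,x_1,\ldots)\in I^{\mathbb{N}_0}: f(x_i)=x_{i-1},\ i\in\mathbb{N}\}$ with the product topology. An arc is a space homeomorphic to $[0,1]$. For a map $g\colon I\to I$, $\mathrm{Fix}(g)=\{y\in I: g(y)=y\}$, and a point $x\in I$ is $g$-attracted to $y\in I$ if $g^n(x)\to y$ as $n\to\infty$. Here $f^2=f\circ f$. *)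

theory Defs
  imports "HOL-Analysis.Analysis"
begin

text \<open>A map \<open>f : I \<rightarrow> I\<close> on the unit interval is a function on the reals of which only the
  values on \<open>{0..1}\<close> matter.\<close>

definition interval_map :: "(real \<Rightarrow> real) \<Rightarrow> bool" where
  "interval_map f \<longleftrightarrow> continuous_on {0..1} f \<and> f ` {0..1} = {0..1}"

text \<open>The neighbourhoods \<open>J\<close> are open relative to the unit interval, since \<open>f\<close> lives only there.\<close>

definition critical_point :: "(real \<Rightarrow> real) \<Rightarrow> real \<Rightarrow> bool" where
  "critical_point f c \<longleftrightarrow> c \<in> {0<..<1} \<and>
     (\<forall>J. openin (top_of_set {0..1}) J \<and> c \<in> J \<longrightarrow> \<not> inj_on f J)"

definition piecewise_monotone :: "(real \<Rightarrow> real) \<Rightarrow> bool" where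
  "piecewise_monotone f \<longleftrightarrow> finite {c. critical_point f c}"

text \<open>The library topology on \<^typ>\<open>nat \<Rightarrow> real\<close> is the product topology, so the set below carries
  the required topology as a subspace.\<close>

definition inverse_limit :: "(real \<Rightarrow> real) \<Rightarrow> (nat \<Rightarrow> real) set" where
  "inverse_limit f = {x. (\<forall>i. x i \<in> {0..1}) \<and> (\<forall>i. f (x (Suc i)) = x i)}"

text \<open>The library predicate \<^const>\<open>arc\<close> concerns injective paths; here an arc is a space.\<close>

definition arc_space :: "'a::topological_space set \<Rightarrow> bool" where
  "arc_space X \<longleftrightarrow> X homeomorphic {0..1::real}"

definition fix_set :: "(real \<Rightarrow> real) \<Rightarrow> real set" where
  "fix_set g = {y \<in> {0..1}. g y = y}"

definition attracted_to :: "(real \<Rightarrow> real) \<Rightarrow> real \<Rightarrow> real \<Rightarrow> bool" where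
  "attracted_to g x y \<longleftrightarrow> (\<lambda>n. (g ^^ n) x) \<longlonglongrightarrow> y"

end

theory Submission
  imports Defs
begin

text \<open>Write \<open>g = f \<circ> f\<close> and let \<open>X\<close> be the inverse limit of \<open>f\<close>. The even coordinates of a point of
\<open>X\<close> form a backward orbit of \<open>g\<close> and determine the point, so \<open>X\<close> is the space of backward
orbits of \<open>g\<close>.

Suppose that \<open>X\<close> is an arc. The shift is a homeomorphism of \<open>X\<close>, hence strictly monotone in a
parameter of the arc, and its square \<open>H\<close> is strictly increasing. Orbits of an increasing map of the
interval converge, and coordinate \<open>0\<close> carries \<open>H\<close> to \<open>g\<close>; so every point is attracted to a fixed
point of \<open>g\<close>. Backward orbits of \<open>H\<close> converge as well, and all parameters strictly between the
backward limit and the current point share one forward limit. By the intermediate value theorem,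
every non-fixed point that lies between the limit of a backward orbit of \<open>g\<close> and its start is
attracted to the same point as the start (\<open>backward_orbit_limit\<close>). For two points of one component
of the complement of the fixed points, one of them has a backward orbit whose limit lies beyond the
other (\<open>one_limit_determines_other\<close>).

Conversely, suppose that \<open>g\<close> has the attraction property. As \<open>X\<close> is compact and connected, a
continuous injection of \<open>X\<close> into the line makes it an arc. The injection comes from levels \<open>t\<close>
that \<open>g\<close> crosses only once, upwards, at a preimage which is a level of the same kind, and so on
forever (\<open>cut_point\<close>). Such a \<open>t\<close> is coordinate \<open>0\<close> of at most one point of \<open>X\<close> and separates the
rest of \<open>X\<close> into two sides, and the same two sides are seen in all deeper coordinates. All cuts,
taken at all coordinates, are therefore compatible with one linear order. Consequently the measure
of the set of cut points below a coordinate is monotone in this order, whichever coordinate is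
used, and the weighted sum over all even coordinates (\<open>height\<close>) is continuous; it is injective
if there are enough cut points.

That there are enough of them is where the dynamics enters. A point that is moved by \<open>g\<close> is
attracted to the neighbouring fixed point on the side to which it moves (\<open>attracted_next\<close>).
Hence orbits never return past their start (\<open>iterate_gt\<close>), and a backward orbit that is not
constant is finally monotone and converges to a fixed point which is repelling on the side of
approach. Finiteness of the set of critical points makes \<open>g\<close> increasing there, and a nearby level
has no other preimage, because such a preimage would be attracted to the wrong fixed point
(\<open>collar_right\<close>). So every backward orbit finally consists of fixed points or of interior points of the set of cut points
(\<open>backward_eventually\<close>), and such interior points occur between any two fixed points
(\<open>core_between_fixed\<close>).\<close>

section \<open>Reflection of the interval and attraction\<close>

text \<open>Conjugation by \<open>x \<mapsto> 1 - x\<close>. It exchanges left and right, so that most one-sided statements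
below are proved on one side only.\<close>

definition reflect :: "(real \<Rightarrow> real) \<Rightarrow> real \<Rightarrow> real" where
  "reflect g x = 1 - g (1 - x)"

lemma reflect_funpow: "(reflect g ^^ n) x = 1 - (g ^^ n) (1 - x)"
  by (induction n) (auto simp: reflect_def)

lemma fix_set_reflect: "x \<in> fix_set (reflect g) \<longleftrightarrow> 1 - x \<in> fix_set g"
  by (auto simp: fix_set_def reflect_def)

lemma attracted_reflect: "attracted_to (reflect g) x y \<longleftrightarrow> attracted_to g (1 - x) (1 - y)"
proof
  assume "attracted_to (reflect g) x y"
  then have "(\<lambda>n. 1 - (reflect g ^^ n) x) \<longlonglongrightarrow> 1 - y"
    unfolding attracted_to_def by (intro tendsto_intros)
  then show "attracted_to g (1 - x) (1 - y)"
    by (simp add: attracted_to_def reflect_funpow)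
next
  assume "attracted_to g (1 - x) (1 - y)"
  then have "(\<lambda>n. 1 - (g ^^ n) (1 - x)) \<longlonglongrightarrow> 1 - (1 - y)"
    unfolding attracted_to_def by (intro tendsto_intros)
  then show "attracted_to (reflect g) x y"
    by (simp add: attracted_to_def reflect_funpow)
qed

lemma attracted_unique: "attracted_to g x p \<Longrightarrow> attracted_to g x q \<Longrightarrow> p = q"
  unfolding attracted_to_def by (rule LIMSEQ_unique)

lemma attracted_step: "attracted_to g (g x) p \<longleftrightarrow> attracted_to g x p"
proof -
  have "(g ^^ n) (g x) = (g ^^ Suc n) x" for n
    by (simp add: funpow_swap1)
  then show ?thesis
    unfolding attracted_to_def using filterlim_sequentially_Suc[of "\<lambda>n. (g ^^ n) x" "nhds p"] by simp
qed

lemma attracted_fixed: "g p = p \<Longrightarrow> attracted_to g p p"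
proof -
  assume "g p = p"
  then have "(g ^^ n) p = p" for n by (induction n) auto
  then show ?thesis by (simp add: attracted_to_def)
qed

section \<open>Cut points\<close>

text \<open>The greatest fixed point is what is wanted: the condition has to hold along an infinite sequence of
preimages. Only the behaviour on the unit interval is recorded, so all large levels
outside it are cut points too; only those inside are measured later.\<close>

coinductive cut_point :: "(real \<Rightarrow> real) \<Rightarrow> real \<Rightarrow> bool" for g where
  cut: "cut_point g s \<Longrightarrow>
    \<forall>y\<in>{0..1}. (y < s \<longrightarrow> g y < t) \<and> (s < y \<longrightarrow> t < g y) \<Longrightarrow> cut_point g t"

abbreviation "cut_core g \<equiv> interior {t. cut_point g t}"

lemma cut_point_reflect_imp: "cut_point g t \<Longrightarrow> cut_point (reflect g) (1 - t)"
proof (coinduction arbitrary: t)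
  case cut_point
  then obtain s where s: "cut_point g s"
    "\<forall>y\<in>{0..1}. (y < s \<longrightarrow> g y < t) \<and> (s < y \<longrightarrow> t < g y)"
    by (auto elim: cut_point.cases)
  have "\<forall>y\<in>{0..1}. (y < 1 - s \<longrightarrow> reflect g y < 1 - t) \<and> (1 - s < y \<longrightarrow> 1 - t < reflect g y)"
  proof
    fix y :: real assume "y \<in> {0..1}"
    then show "(y < 1 - s \<longrightarrow> reflect g y < 1 - t) \<and> (1 - s < y \<longrightarrow> 1 - t < reflect g y)"
      using bspec[OF s(2), of "1 - y"] by (auto simp: reflect_def)
  qed
  then show ?case using s(1) by blast
qed

lemma reflect_reflect [simp]: "reflect (reflect g) = g"
  by (auto simp: reflect_def fun_eq_iff)

lemma cut_point_reflect: "cut_point (reflect g) t \<longleftrightarrow> cut_point g (1 - t)"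
  using cut_point_reflect_imp[of g "1 - t"] cut_point_reflect_imp[of "reflect g" t] by auto

lemma cut_core_iff:
  "t \<in> cut_core g \<longleftrightarrow> (\<exists>e>0. \<forall>u. \<bar>u - t\<bar> < e \<longrightarrow> cut_point g u)"
  by (auto simp: mem_interior subset_iff dist_real_def abs_minus_commute)

lemma cut_core_reflect: "t \<in> cut_core (reflect g) \<longleftrightarrow> 1 - t \<in> cut_core g"
proof -
  have "(\<forall>u. \<bar>u - t\<bar> < e \<longrightarrow> cut_point g (1 - u)) \<longleftrightarrow> (\<forall>u. \<bar>u - (1 - t)\<bar> < e \<longrightarrow> cut_point g u)"
    for e :: real
  proof (intro iffI allI impI)
    fix u assume "\<forall>u. \<bar>u - t\<bar> < e \<longrightarrow> cut_point g (1 - u)" "\<bar>u - (1 - t)\<bar> < e"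
    moreover from this(2) have "\<bar>(1 - u) - t\<bar> < e" by linarith
    ultimately show "cut_point g u" by fastforce
  next
    fix u assume "\<forall>u. \<bar>u - (1 - t)\<bar> < e \<longrightarrow> cut_point g u" "\<bar>u - t\<bar> < e"
    moreover from this(2) have "\<bar>(1 - u) - (1 - t)\<bar> < e" by linarith
    ultimately show "cut_point g (1 - u)" by fastforce
  qed
  then show ?thesis
    using cut_core_iff[of t "reflect g"] cut_core_iff[of "1 - t" g] by (simp add: cut_point_reflect)
qed

section \<open>Backward orbits and maps of the unit interval\<close>

lemma backward_iterate:
  assumes "\<And>n. g (x (Suc n)) = x n"
  shows "(g ^^ k) (x (n + k)) = x n"
proof (induction k)
  case (Suc k)
  have "(g ^^ Suc k) (x (n + Suc k)) = (g ^^ k) (g (x (Suc (n + k))))"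
    by (simp add: funpow_swap1)
  then show ?case using Suc assms by simp
qed simp

text \<open>A sequence that visits both \<open>P\<close> and \<open>Q\<close> infinitely often, and finally nothing else, must step
from \<open>P\<close> into \<open>Q\<close> infinitely often.\<close>

lemma frequently_switch:
  assumes "\<exists>\<^sub>F n in sequentially. P n" "\<exists>\<^sub>F n in sequentially. Q n"
    and "\<forall>\<^sub>F n in sequentially. P n \<or> Q n"
  shows "\<exists>\<^sub>F n in sequentially. P n \<and> Q (Suc n)"
proof (rule ccontr)
  assume "\<not> ?thesis"
  then have "\<forall>\<^sub>F n in sequentially. P n \<longrightarrow> \<not> Q (Suc n)" by (simp add: frequently_def)
  moreover have "\<forall>\<^sub>F n in sequentially. P (Suc n) \<or> Q (Suc n)"
    using assms(3) by (simp add: eventually_sequentially_Suc[of "\<lambda>n. P n \<or> Q n"])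
  ultimately have "\<forall>\<^sub>F n in sequentially. P n \<longrightarrow> P (Suc n) \<and> \<not> Q (Suc n)"
    by eventually_elim auto
  then obtain K where K: "\<And>n. n \<ge> K \<Longrightarrow> P n \<Longrightarrow> P (Suc n) \<and> \<not> Q (Suc n)"
    by (auto simp: eventually_sequentially)
  obtain n where n: "n \<ge> K" "P n" using assms(1) by (auto simp: frequently_sequentially)
  have *: "P (n + k)" for k by (induction k) (use n K[of "n + _"] in auto)
  obtain m where m: "m \<ge> Suc n" "Q m" using assms(2) by (auto simp: frequently_sequentially)
  have "P (m - 1)" "m - 1 \<ge> K" using *[of "m - 1 - n"] m n by simp_all
  then show False using K[of "m - 1"] m by simp
qed

locale unit_interval_map =
  fixes g :: "real \<Rightarrow> real"
  assumes interval: "interval_map g"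
begin

lemma cont: "continuous_on {0..1} g"
  using interval by (simp add: interval_map_def)

lemma onto: "g ` {0..1} = {0..1}"
  using interval by (simp add: interval_map_def)

lemma mem [simp]: "x \<in> {0..1} \<Longrightarrow> g x \<in> {0..1}"
  using onto by blast

lemma iter_mem: "x \<in> {0..1} \<Longrightarrow> (g ^^ n) x \<in> {0..1}"
  by (induction n) (use mem in auto)

lemma cont_sub: "S \<subseteq> {0..1} \<Longrightarrow> continuous_on S g"
  using cont continuous_on_subset by blast

lemma compact_fix: "compact (fix_set g \<inter> {a..b})"
proof -
  have "closed {x \<in> {0..1}. g x - x = 0}"
    by (rule continuous_closed_preimage_constant) (intro continuous_intros cont, simp)
  moreover have "{x \<in> {0..1}. g x - x = 0} = fix_set g"
    by (auto simp: fix_set_def)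
  ultimately have "closed (fix_set g)" by simp
  then show ?thesis by (simp add: closed_Int_compact)
qed

lemma fix_between:
  assumes "x \<in> {0..1}" "y \<in> {0..1}" "g x \<ge> x" "g y \<le> y"
  shows "\<exists>p\<in>closed_segment x y. p \<in> fix_set g"
proof -
  have sub: "closed_segment x y \<subseteq> {0..1}"
    using assms by (auto simp: closed_segment_eq_real_ivl)
  then have "continuous_on (closed_segment x y) (\<lambda>x. g x - x)"
    by (intro continuous_intros cont_sub)
  then have "connected ((\<lambda>x. g x - x) ` closed_segment x y)"
    by (intro connected_continuous_image) auto
  then have "0 \<in> (\<lambda>x. g x - x) ` closed_segment x y"
    using connectedD_interval[of "(\<lambda>x. g x - x) ` closed_segment x y" "g y - y" "g x - x" 0] assms
    by auto
  then show ?thesis using sub by (auto simp: fix_set_def subset_iff)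
qed

lemma value_between:
  assumes "x \<in> {0..1}" "y \<in> {0..1}" "g x \<le> c" "c \<le> g y"
  shows "\<exists>z\<in>closed_segment x y. g z = c"
proof -
  have sub: "closed_segment x y \<subseteq> {0..1}"
    using assms by (auto simp: closed_segment_eq_real_ivl)
  then have "connected (g ` closed_segment x y)"
    by (intro connected_continuous_image cont_sub) auto
  then have "c \<in> g ` closed_segment x y"
    using connectedD_interval[of "g ` closed_segment x y" "g x" "g y" c] assms by auto
  then show ?thesis by auto
qed

lemma fixed_if_image_limit:
  assumes "\<And>n. x n \<in> {0..1}" "x \<longlonglongrightarrow> p" "(\<lambda>n. g (x n)) \<longlonglongrightarrow> p"
  shows "p \<in> fix_set g"
proof -
  have p: "p \<in> {0..1}" using closed_sequentially[of "{0..1}" x p] assms by auto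
  have "(\<lambda>n. g (x n)) \<longlonglongrightarrow> g p"
    using continuous_on_tendsto_compose[OF cont assms(2) p] assms(1) by auto
  then show ?thesis
    using assms LIMSEQ_unique p by (auto simp: fix_set_def)
qed

lemma limit_is_fixed:
  assumes "\<And>n. x n \<in> {0..1}" "\<And>n. g (x (Suc n)) = x n" "x \<longlonglongrightarrow> p"
  shows "p \<in> fix_set g"
  by (rule fixed_if_image_limit[of "\<lambda>n. x (Suc n)"]) (use assms LIMSEQ_Suc in auto)

lemma backward_orbit_within:
  assumes "S \<subseteq> g ` S" "z \<in> S"
  obtains x where "x 0 = z" "\<And>n. x n \<in> S" "\<And>n. g (x (Suc n)) = x n"
proof -
  define s where "s = inv_into S g"
  have s: "s y \<in> S" "g (s y) = y" if "y \<in> S" for y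
    using that assms(1) by (auto simp: s_def inv_into_into f_inv_into_f subset_iff)
  have "(s ^^ n) z \<in> S" for n by (induction n) (use s assms(2) in auto)
  then show thesis using that[of "\<lambda>n. (s ^^ n) z"] s(2) by simp
qed

end

section \<open>Maps with the attraction property\<close>

text \<open>The hypothesis on components appears here as \<open>same\<close>, in terms of segments free of fixed points.
All that is kept of piecewise monotonicity is injectivity on a one-sided neighbourhood of each fixed
point. In this form the assumptions are visibly invariant under reflection.\<close>

locale attracting_map = unit_interval_map +
  assumes conv: "x \<in> {0..1} \<Longrightarrow> \<exists>p\<in>fix_set g. attracted_to g x p"
    and same: "\<lbrakk>x \<in> {0..1}; y \<in> {0..1}; closed_segment x y \<inter> fix_set g = {}; attracted_to g x p\<rbrakk>
      \<Longrightarrow> attracted_to g y p"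
    and inj_right: "\<lbrakk>p \<in> fix_set g; p < 1\<rbrakk> \<Longrightarrow> \<exists>e>0. p + e \<le> 1 \<and> inj_on g {p..p+e}"
    and inj_left: "\<lbrakk>p \<in> fix_set g; 0 < p\<rbrakk> \<Longrightarrow> \<exists>e>0. 0 \<le> p - e \<and> inj_on g {p-e..p}"
begin

lemma reflect_attracting: "attracting_map (reflect g)"
proof
  have "continuous_on {0..1} (\<lambda>x. 1 - g (1 - x))"
    by (intro continuous_intros continuous_on_compose2[OF cont]) auto
  moreover have "(\<lambda>x. 1 - g (1 - x)) ` {0..1} = {0..1}"
  proof
    show "(\<lambda>x. 1 - g (1 - x)) ` {0..1} \<subseteq> {0..1}"
    proof
      fix y assume "y \<in> (\<lambda>x. 1 - g (1 - x)) ` {0..1}"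
      then obtain x where "x \<in> {0..1}" "y = 1 - g (1 - x)" by auto
      then show "y \<in> {0..1}" using mem[of "1 - x"] by auto
    qed
    show "{0..1} \<subseteq> (\<lambda>x. 1 - g (1 - x)) ` {0..1}"
    proof
      fix y :: real assume "y \<in> {0..1}"
      then have "1 - y \<in> g ` {0..1}" using onto by auto
      then obtain x where "x \<in> {0..1}" "1 - y = g x" by auto
      then show "y \<in> (\<lambda>x. 1 - g (1 - x)) ` {0..1}"
        by (intro image_eqI[of _ _ "1 - x"]) auto
    qed
  qed
  ultimately show "interval_map (reflect g)"
    by (simp add: interval_map_def reflect_def[abs_def])
next
  fix x :: real assume "x \<in> {0..1}"
  then obtain p where "p \<in> fix_set g" "attracted_to g (1 - x) p"
    using conv[of "1 - x"] by auto
  then show "\<exists>p\<in>fix_set (reflect g). attracted_to (reflect g) x p"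
    by (intro bexI[of _ "1 - p"]) (auto simp: fix_set_reflect attracted_reflect)
next
  fix x y p :: real
  assume *: "x \<in> {0..1}" "y \<in> {0..1}" "closed_segment x y \<inter> fix_set (reflect g) = {}"
    "attracted_to (reflect g) x p"
  have "closed_segment (1 - x) (1 - y) \<inter> fix_set g = {}"
  proof (rule ccontr)
    assume "closed_segment (1 - x) (1 - y) \<inter> fix_set g \<noteq> {}"
    then obtain q where "q \<in> closed_segment (1 - x) (1 - y)" "q \<in> fix_set g" by auto
    then have "1 - q \<in> closed_segment x y \<inter> fix_set (reflect g)"
      by (auto simp: fix_set_reflect closed_segment_eq_real_ivl split: if_splits)
    then show False using * by auto
  qed
  then show "attracted_to (reflect g) y p"
    using same[of "1 - x" "1 - y" "1 - p"] * by (simp add: attracted_reflect)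
next
  fix p :: real assume "p \<in> fix_set (reflect g)" "p < 1"
  then obtain e where e: "e > 0" "0 \<le> 1 - p - e" "inj_on g {1-p-e..1-p}"
    using inj_left[of "1 - p"] by (auto simp: fix_set_reflect)
  have "inj_on (reflect g) {p..p+e}"
  proof (rule inj_onI)
    fix x y assume "x \<in> {p..p+e}" "y \<in> {p..p+e}" "reflect g x = reflect g y"
    then show "x = y"
      using inj_onD[OF e(3), of "1 - x" "1 - y"] by (auto simp: reflect_def)
  qed
  then show "\<exists>e>0. p + e \<le> 1 \<and> inj_on (reflect g) {p..p+e}"
    using e by (intro exI[of _ e]) auto
next
  fix p :: real assume "p \<in> fix_set (reflect g)" "0 < p"
  then obtain e where e: "e > 0" "1 - p + e \<le> 1" "inj_on g {1-p..1-p+e}"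
    using inj_right[of "1 - p"] by (auto simp: fix_set_reflect)
  have "inj_on (reflect g) {p-e..p}"
  proof (rule inj_onI)
    fix x y assume "x \<in> {p-e..p}" "y \<in> {p-e..p}" "reflect g x = reflect g y"
    then show "x = y"
      using inj_onD[OF e(3), of "1 - x" "1 - y"] by (auto simp: reflect_def)
  qed
  then show "\<exists>e>0. 0 \<le> p - e \<and> inj_on (reflect g) {p-e..p}"
    using e by (intro exI[of _ e]) auto
qed

lemma nearest_fix_above:
  assumes "q \<in> fix_set g" "x \<le> q"
  obtains b where "b \<in> fix_set g" "x \<le> b" "b \<le> q" "{x..<b} \<inter> fix_set g = {}"
proof -
  have "fix_set g \<inter> {x..q} \<noteq> {}" using assms by auto
  from compact_attains_inf[OF compact_fix this] obtain b where
    b: "b \<in> fix_set g \<inter> {x..q}" "\<forall>c\<in>fix_set g \<inter> {x..q}. b \<le> c" by blast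
  have "c \<notin> fix_set g" if "c \<in> {x..<b}" for c
    using b that by (auto simp: not_le[symmetric])
  then have "{x..<b} \<inter> fix_set g = {}" by blast
  then show thesis using b that by auto
qed

lemma nearest_fix_below:
  assumes "q \<in> fix_set g" "q \<le> x"
  obtains a where "a \<in> fix_set g" "a \<le> x" "q \<le> a" "{a<..x} \<inter> fix_set g = {}"
proof -
  interpret r: attracting_map "reflect g" by (rule reflect_attracting)
  obtain b where b: "b \<in> fix_set (reflect g)" "1 - x \<le> b" "b \<le> 1 - q"
    "{1-x..<b} \<inter> fix_set (reflect g) = {}"
    using r.nearest_fix_above[of "1 - q" "1 - x"] assms by (auto simp: fix_set_reflect)
  have "c \<notin> fix_set g" if "c \<in> {1-b<..x}" for c
  proof -
    have "1 - c \<in> {1-x..<b}" using that by auto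
    then have "1 - c \<notin> fix_set (reflect g)" using b(4) by blast
    then show ?thesis by (simp add: fix_set_reflect)
  qed
  then have "{1-b<..x} \<inter> fix_set g = {}" by blast
  then show thesis using b that[of "1 - b"] by (auto simp: fix_set_reflect)
qed

lemma gt_on_segment:
  assumes "x \<in> {0..1}" "y \<in> {0..1}" "g x > x" "closed_segment x y \<inter> fix_set g = {}"
  shows "g y > y"
  using fix_between[of x y] assms by force

lemma same_le:
  assumes "x \<in> {0..1}" "y \<in> {0..1}" "x \<le> y" "{x..y} \<inter> fix_set g = {}"
  shows "attracted_to g x p \<longleftrightarrow> attracted_to g y p"
  using same[of x y p] same[of y x p] assms
  by (simp add: closed_segment_commute[of y x] closed_segment_eq_real_ivl1) blast

lemma fix_above:
  assumes "x \<in> {0..1}" "g x > x"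
  obtains b where "b \<in> fix_set g" "x < b" "{x..<b} \<inter> fix_set g = {}"
proof -
  obtain q where q: "q \<in> fix_set g" "x \<le> q"
    using fix_between[of x 1] assms mem[of 1] by (auto simp: closed_segment_eq_real_ivl)
  then obtain b where "b \<in> fix_set g" "x \<le> b" "{x..<b} \<inter> fix_set g = {}"
    by (rule nearest_fix_above)
  moreover have "x \<noteq> b" using assms \<open>b \<in> fix_set g\<close> by (auto simp: fix_set_def)
  ultimately show thesis using that by auto
qed

lemma fix_below:
  assumes "x \<in> {0..1}" "g x < x"
  obtains a where "a \<in> fix_set g" "a < x" "{a<..x} \<inter> fix_set g = {}"
proof -
  obtain q where q: "q \<in> fix_set g" "q \<le> x"
    using fix_between[of 0 x] assms mem[of 0] by (auto simp: closed_segment_eq_real_ivl)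
  then obtain a where "a \<in> fix_set g" "a \<le> x" "{a<..x} \<inter> fix_set g = {}"
    by (rule nearest_fix_below)
  moreover have "x \<noteq> a" using assms \<open>a \<in> fix_set g\<close> by (auto simp: fix_set_def)
  ultimately show thesis using that by auto
qed

lemma gt_until:
  assumes "x \<in> {0..1}" "g x > x" "b \<in> {0..1}" "{x..<b} \<inter> fix_set g = {}" "y \<in> {x..<b}"
  shows "g y > y"
  using gt_on_segment[of x y] assms by (fastforce simp: closed_segment_eq_real_ivl)

lemma attracted_if_hits:
  assumes "x \<in> {0..1}" "y \<in> {0..1}" "closed_segment x y \<inter> fix_set g = {}"
    "b \<in> fix_set g" "g y = b"
  shows "attracted_to g x b"
proof -
  have "attracted_to g y b"
    using assms attracted_step[of g y b] attracted_fixed[of g b] by (auto simp: fix_set_def)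
  then show ?thesis
    using same[of y x b] assms by (simp add: closed_segment_commute)
qed

text \<open>If the orbit of \<open>x\<close> stays below \<open>b\<close>, it increases to \<open>b\<close>. Otherwise some point of the component
is mapped to \<open>b\<close> or above it, points near the fixed point below are mapped below \<open>b\<close>, so some point of
the component is mapped exactly to \<open>b\<close>, and the whole component is attracted to \<open>b\<close>.\<close>

lemma attracted_next_if_fixed_below:
  assumes "x \<in> {0..1}" "g x > x" "b \<in> fix_set g" "x < b" "{x..<b} \<inter> fix_set g = {}"
    and "a \<in> fix_set g" "a \<le> x"
  shows "attracted_to g x b"
proof (cases "\<forall>n. (g ^^ n) x < b")
  case True
  have b: "b \<in> {0..1}" using assms by (auto simp: fix_set_def)
  have *: "(g ^^ n) x \<in> {x..<b}" for n
  proof (induction n)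
    case (Suc n)
    then show ?case using gt_until[of x b "(g ^^ n) x"] True[rule_format, of "Suc n"] assms b by auto
  qed (use assms in auto)
  have "(g ^^ n) x \<le> (g ^^ Suc n) x" for n
    using gt_until[of x b "(g ^^ n) x"] * assms b by fastforce
  then have inc: "incseq (\<lambda>n. (g ^^ n) x)" by (rule incseq_SucI)
  obtain p where p: "p \<in> fix_set g" "attracted_to g x p" using conv[OF assms(1)] by auto
  have "p \<le> b"
    using LIMSEQ_le_const2[of "\<lambda>n. (g ^^ n) x" p b] p(2) True
    by (auto simp: attracted_to_def intro: less_imp_le)
  moreover have "x \<le> p" using incseq_le[OF inc, of p 0] p(2) by (auto simp: attracted_to_def)
  moreover have "p \<notin> {x..<b}" using assms(5) p(1) by blast
  ultimately have "p = b" by auto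
  then show ?thesis using p by simp
next
  case False
  define m where "m = (LEAST n. \<not> (g ^^ n) x < b)"
  have m: "\<not> (g ^^ m) x < b" "\<And>i. i < m \<Longrightarrow> (g ^^ i) x < b"
    using LeastI_ex[of "\<lambda>n. \<not> (g ^^ n) x < b"] not_less_Least[of _ "\<lambda>n. \<not> (g ^^ n) x < b"] False
    by (auto simp: m_def)
  have b: "b \<in> {0..1}" using assms by (auto simp: fix_set_def)
  have *: "i < m \<Longrightarrow> (g ^^ i) x \<in> {x..<b}" for i
  proof (induction i)
    case (Suc n)
    then show ?case using gt_until[of x b "(g ^^ n) x"] m(2)[of "Suc n"] assms b by auto
  qed (use assms in auto)
  obtain k where k: "m = Suc k" using m(1) assms by (cases m) auto
  define y where "y = (g ^^ k) x"
  have y: "y \<in> {x..<b}" "b \<le> g y" using *[of k] m(1) by (auto simp: y_def k)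
  obtain c where c: "c \<in> fix_set g" "c \<le> x" "{c<..x} \<inter> fix_set g = {}"
    by (rule nearest_fix_below[OF assms(6,7)])
  have "c < b" "y \<in> {0..1}" "c \<in> {0..1}" "g c = c" using c y assms b by (auto simp: fix_set_def)
  then obtain z where z: "z \<in> closed_segment c y" "g z = b"
    using value_between[of c y b] y(2) by auto
  have "z \<noteq> c" using z \<open>c < b\<close> \<open>g c = c\<close> by auto
  then have z': "c < z" "z < b" "z \<in> {0..1}"
    using z y c \<open>c < b\<close> b \<open>c \<in> {0..1}\<close> \<open>y \<in> {0..1}\<close> by (auto simp: closed_segment_eq_real_ivl)
  have "closed_segment x z \<subseteq> {c<..x} \<union> {x..<b}"
    using z'(1,2) by (auto simp: closed_segment_eq_real_ivl)
  then have "closed_segment x z \<inter> fix_set g = {}" using c assms by blast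
  then show ?thesis using attracted_if_hits[of x z b] z z' assms by simp
qed

text \<open>It remains to treat a component that contains the end point \<open>0\<close>. Surjectivity provides
a point \<open>w\<close> above \<open>b\<close> with \<open>g w = 0\<close>, which therefore has the same limit as \<open>x\<close>. Going down from
\<open>w\<close>, and then up from it, to the next fixed point gives a point that is mapped to \<open>b\<close>, unless
\<open>b\<close> is the only fixed point.\<close>

lemma attracted_next:
  assumes x: "x \<in> {0..1}" "g x > x" and b: "b \<in> fix_set g" "x < b" "{x..<b} \<inter> fix_set g = {}"
  shows "attracted_to g x b"
proof (cases "\<exists>a\<in>fix_set g. a \<le> x")
  case True
  then show ?thesis using attracted_next_if_fixed_below assms by blast
next
  case False
  have b01: "b \<in> {0..1}" "g b = b" using b by (auto simp: fix_set_def)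
  have "c \<notin> fix_set g" if "c \<in> {0..<b}" for c
  proof (cases "c \<le> x")
    case True
    then show ?thesis using False by blast
  next
    case False
    then have "c \<in> {x..<b}" using that by auto
    then show ?thesis using b(3) by blast
  qed
  then have x0: "{0..<b} \<inter> fix_set g = {}" by blast
  have gt: "g y > y" if y: "y \<in> {0..<b}" for y
  proof (rule gt_on_segment[OF x(1) _ x(2)])
    have "closed_segment x y \<subseteq> {0..<b}" using y x b by (auto simp: closed_segment_eq_real_ivl)
    then show "closed_segment x y \<inter> fix_set g = {}" using x0 by blast
  qed (use y b01 in auto)
  have to0: "attracted_to g x p" if "attracted_to g 0 p" for p
    using same_le[of 0 x p] that x x0 b by force
  have "0 \<in> g ` {0..1}" using onto by simp
  then obtain w where w: "w \<in> {0..1}" "g w = 0" by auto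
  have wb: "b < w"
  proof (rule ccontr)
    assume "\<not> b < w"
    then show False using gt[of w] w b b01 x by (cases "w = b") auto
  qed
  have w0: "attracted_to g x p" if "attracted_to g w p" for p
    using that to0[of p] w attracted_step[of g w p] by simp
  obtain c where c: "c \<in> fix_set g" "c < w" "{c<..w} \<inter> fix_set g = {}"
    using fix_below[of w] w wb b01 by auto
  have "b \<notin> {c<..w}" using c(3) b(1) by blast
  then have bc: "b \<le> c" using wb by auto
  have c01: "c \<in> {0..1}" "g c = c" using c by (auto simp: fix_set_def)
  obtain z where z: "z \<in> {c..w}" "g z = b"
    using value_between[of w c b] w c01 bc b01 c(2) by (auto simp: closed_segment_eq_real_ivl)
  show ?thesis
  proof (cases "z = c")
    case False
    then have "closed_segment w z \<subseteq> {c<..w}" "z \<in> {0..1}"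
      using z(1) w c01 by (auto simp: closed_segment_eq_real_ivl split: if_splits)
    then have "closed_segment w z \<inter> fix_set g = {}" "z \<in> {0..1}" using c(3) by blast+
    then show ?thesis using attracted_if_hits[of w z b] w0 z w b by simp
  next
    case True
    then have cb: "c = b" using z c01 by simp
    show ?thesis
    proof (cases "\<exists>q\<in>fix_set g. w \<le> q")
      case True
      then obtain q where q: "q \<in> fix_set g" "w \<le> q" by blast
      obtain d where d: "d \<in> fix_set g" "w \<le> d" "{w..<d} \<inter> fix_set g = {}"
        by (rule nearest_fix_above[OF q])
      have d01: "d \<in> {0..1}" "g d = d" using d by (auto simp: fix_set_def)
      obtain z where z: "z \<in> {w..d}" "g z = b"
        using value_between[of w d b] w d01 d wb b01 by (auto simp: closed_segment_eq_real_ivl)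
      have "z \<noteq> d" using z d01 wb d by auto
      then have "closed_segment w z \<subseteq> {w..<d}" "z \<in> {0..1}"
        using z(1) w d01 by (auto simp: closed_segment_eq_real_ivl)
      then have "closed_segment w z \<inter> fix_set g = {}" "z \<in> {0..1}" using d(3) by blast+
      then show ?thesis using attracted_if_hits[of w z b] w0 z w b by simp
    next
      case no: False
      have "p = b" if "p \<in> fix_set g" for p
      proof (rule ccontr)
        assume "p \<noteq> b"
        have "p \<in> {0..1}" using that by (auto simp: fix_set_def)
        then consider "p \<in> {0..<b}" | "p \<in> {c<..w}" | "w \<le> p" using cb \<open>p \<noteq> b\<close> by force
        then show False using that x0 c(3) no by cases blast+
      qed
      then show ?thesis using conv[OF x(1)] by blast
    qed
  qed
qed

lemma attracted_prev:
  assumes "x \<in> {0..1}" "g x < x" "a \<in> fix_set g" "a < x" "{a<..x} \<inter> fix_set g = {}"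
  shows "attracted_to g x a"
proof -
  have "c \<notin> fix_set (reflect g)" if "c \<in> {1-x..<1-a}" for c
  proof -
    have "1 - c \<in> {a<..x}" using that by auto
    then show ?thesis using assms(5) by (auto simp: fix_set_reflect)
  qed
  then have "attracted_to (reflect g) (1 - x) (1 - a)"
    by (intro attracting_map.attracted_next[OF reflect_attracting]) (use assms in \<open>auto simp: fix_set_reflect\<close>, auto simp: reflect_def)
  then show ?thesis by (simp add: attracted_reflect)
qed

text \<open>A fixed point is a barrier for limits, although the orbit itself may jump over it.\<close>

lemma limit_le_fix:
  assumes "x \<in> {0..1}" "x \<le> p" "p \<in> fix_set g" "attracted_to g x q"
  shows "q \<le> p"
proof -
  consider "g x = x" | "g x > x" | "g x < x" by linarith
  then show ?thesis
  proof cases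
    case 1
    then show ?thesis using attracted_fixed attracted_unique assms by metis
  next
    case 2
    then obtain b where b: "b \<in> fix_set g" "x < b" "{x..<b} \<inter> fix_set g = {}"
      using fix_above assms by blast
    then have "q = b" using attracted_next[of x b] 2 assms attracted_unique by blast
    moreover have "b \<le> p" using b(3) assms by force
    ultimately show ?thesis by simp
  next
    case 3
    then obtain a where a: "a \<in> fix_set g" "a < x" "{a<..x} \<inter> fix_set g = {}"
      using fix_below assms by blast
    then have "q = a" using attracted_prev[of x a] 3 assms attracted_unique by blast
    then show ?thesis using a assms by simp
  qed
qed

lemma periodic_fixed:
  assumes "x \<in> {0..1}" "(g ^^ n) x = x" "n > 0"
  shows "g x = x"
proof -
  obtain p where p: "p \<in> fix_set g" "attracted_to g x p" using conv assms by blast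
  have *: "(g ^^ (n * k)) x = x" for k
    by (induction k) (auto simp: funpow_add assms)
  have "strict_mono (\<lambda>k. n * k)" using assms by (auto simp: strict_mono_def)
  then have "(\<lambda>k. (g ^^ (n * k)) x) \<longlonglongrightarrow> p"
    using LIMSEQ_subseq_LIMSEQ[of "\<lambda>n. (g ^^ n) x" p "\<lambda>k. n * k"] p
    by (auto simp: attracted_to_def o_def)
  then have "x = p" unfolding * by (simp add: LIMSEQ_const_iff)
  then show ?thesis using p by (auto simp: fix_set_def)
qed

lemma cont_iterate: "continuous_on {0..1} (g ^^ n)"
proof (induction n)
  case (Suc n)
  have "continuous_on {0..1} (\<lambda>x. g ((g ^^ n) x))"
    by (rule continuous_on_compose2[OF cont Suc]) (use iter_mem in blast)
  then show ?case by (simp add: o_def)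
qed (simp add: id_def)

text \<open>By \<open>periodic_fixed\<close> the sign of \<open>(g ^^ n) y - y\<close> is constant on a segment free of fixed
points. If it were negative at \<open>x\<close>, it would be negative on such a segment to the left of \<open>x\<close>. This fails
at \<open>0\<close>, and also just to the right of the next fixed point below \<open>x\<close>, where the first \<open>n\<close> steps of an
orbit are all increasing.\<close>

lemma iterate_gt:
  assumes x: "x \<in> {0..1}" "g x > x" and n: "n > 0"
  shows "(g ^^ n) x > x"
proof (rule ccontr)
  assume neg: "\<not> (g ^^ n) x > x"
  \<comment> \<open>\<open>(g ^^ n) z - z\<close> cannot vanish between \<open>y\<close> and \<open>x\<close>, so it keeps the sign it has at \<open>x\<close>.\<close>
  have rev: "(g ^^ n) y < y" if y: "y \<in> {0..x}" "{y..x} \<inter> fix_set g = {}" for y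
  proof (rule ccontr)
    assume "\<not> (g ^^ n) y < y"
    moreover have "continuous_on {y..x} (\<lambda>t. (g ^^ n) t - t)"
      using y x by (intro continuous_intros continuous_on_subset[OF cont_iterate]) auto
    ultimately obtain z where z: "y \<le> z" "z \<le> x" "(g ^^ n) z - z = 0"
      using IVT2'[of "\<lambda>t. (g ^^ n) t - t" x 0 y] neg y by auto
    then have "z \<in> fix_set g" using periodic_fixed[of z n] n x y by (auto simp: fix_set_def)
    then show False using z y by auto
  qed
  show False
  proof (cases "\<exists>a\<in>fix_set g. a \<le> x")
    case False
    then have "{0..x} \<inter> fix_set g = {}" by auto
    then have "(g ^^ n) 0 < 0" using rev[of 0] x by auto
    then show False using iter_mem[of 0 n] by auto
  next
    case True
    then obtain q where q: "q \<in> fix_set g" "q \<le> x" by blast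
    obtain a where a: "a \<in> fix_set g" "a \<le> x" "{a<..x} \<inter> fix_set g = {}"
      by (rule nearest_fix_below[OF q])
    have a01: "a \<in> {0..1}" "g a = a" and ax: "a < x" using a x by (auto simp: fix_set_def less_le)
    have ga: "(g ^^ i) a = a" for i by (induction i) (auto simp: a01)
    have near: "\<forall>\<^sub>F y in at_right a. (g ^^ i) y < x" for i
    proof -
      have "((g ^^ i) \<longlongrightarrow> (g ^^ i) a) (at a within {0..1})"
        using cont_iterate a01 by (auto simp: continuous_on_def)
      then have "((g ^^ i) \<longlongrightarrow> a) (at a within {a..x})"
        unfolding ga by (rule tendsto_within_subset) (use a01 x in auto)
      then have "((g ^^ i) \<longlongrightarrow> a) (at_right a)"
        using ax by (simp add: at_within_Icc_at_right)
      then show ?thesis using ax by (rule order_tendstoD)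
    qed
    have gt: "g y > y" if y: "y \<in> {a<..x}" for y
    proof (rule gt_on_segment[OF x(1) _ x(2)])
      have "closed_segment x y \<subseteq> {a<..x}" using y by (auto simp: closed_segment_eq_real_ivl)
      then show "closed_segment x y \<inter> fix_set g = {}" using a(3) by blast
    qed (use y x a01 in auto)
    have "\<forall>\<^sub>F y in at_right a. \<forall>i\<in>{..n}. (g ^^ i) y < x"
      using near by (intro eventually_ball_finite) auto
    moreover have "\<forall>\<^sub>F y in at_right a. y \<in> {a<..<x}"
      using ax by (rule eventually_at_right_real)
    ultimately have "\<forall>\<^sub>F y in at_right a. y \<in> {a<..<x} \<and> (\<forall>i\<in>{..n}. (g ^^ i) y < x)"
      by eventually_elim auto
    then have "\<exists>y. y \<in> {a<..<x} \<and> (\<forall>i\<in>{..n}. (g ^^ i) y < x)"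
      by (rule eventually_happens'[rotated]) simp
    then obtain y where y: "y \<in> {a<..<x}" "\<And>i. i \<le> n \<Longrightarrow> (g ^^ i) y < x"
      by auto
    have orb: "i \<le> n \<Longrightarrow> y \<le> (g ^^ i) y \<and> (g ^^ i) y \<in> {a<..<x}" for i
    proof (induction i)
      case (Suc i)
      then show ?case using gt[of "(g ^^ i) y"] y(2)[of "Suc i"] by auto
    qed (use y in auto)
    have "{y..x} \<subseteq> {a<..x}" using y by auto
    then have "{y..x} \<inter> fix_set g = {}" using a(3) by blast
    then show False using rev[of y] orb[of n] y a01 by auto
  qed
qed

lemma iterate_lt:
  assumes "x \<in> {0..1}" "g x < x" "n > 0"
  shows "(g ^^ n) x < x"
  using attracting_map.iterate_gt[OF reflect_attracting, of "1 - x" n] assms by (simp add: reflect_funpow) (simp add: reflect_def)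

section \<open>Cut points near repelling fixed points\<close>

text \<open>If a point above \<open>p\<close> were mapped to \<open>p\<close> or below, then some \<open>z\<close> above \<open>p\<close> would be mapped to \<open>p\<close>
and hence be attracted to \<open>p\<close>. Such a \<open>z\<close> moves down, and no fixed point separates it from
\<open>p\<close>; but next to \<open>p\<close> points move up.\<close>

lemma right_of_repelling:
  assumes p: "p \<in> fix_set g" and d: "d > 0" "p + d \<le> 1" "\<And>y. y \<in> {p<..p+d} \<Longrightarrow> g y > y"
    and y: "y \<in> {0..1}" "y > p"
  shows "g y > p"
proof (rule ccontr)
  assume "\<not> g y > p"
  have p01: "p \<in> {0..1}" "g p = p" using p by (auto simp: fix_set_def)
  obtain z where z: "p < z" "z \<le> y" "g z = p"
  proof (cases "y \<le> p + d")
    case True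
    then show ?thesis using d(3)[of y] y \<open>\<not> g y > p\<close> by auto
  next
    case False
    have "g (p + d) > p" using d by force
    then obtain z where "z \<in> closed_segment y (p + d)" "g z = p"
      using value_between[of y "p + d" p] y d p01 \<open>\<not> g y > p\<close> by auto
    then show ?thesis using that[of z] False d by (auto simp: closed_segment_eq_real_ivl)
  qed
  have z01: "z \<in> {0..1}" using z y p01 by auto
  have zp: "attracted_to g z p"
    using attracted_step[of g z p] attracted_fixed[of g p] z p01 by simp
  have "g z < z" using z by simp
  then obtain a where a: "a \<in> fix_set g" "a < z" "{a<..z} \<inter> fix_set g = {}"
    using fix_below[of z] z01 by blast
  then have "a = p"
    using attracted_prev[of z a] zp \<open>g z < z\<close> z01 attracted_unique by blast
  define u where "u = min z (p + d)"
  have u: "u \<in> {p<..p+d}" "u \<le> z" using z d by (auto simp: u_def)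
  then have "u \<in> {0..1}" "g u > u" using d p01 by auto
  then obtain q where "q \<in> fix_set g" "q \<in> closed_segment u z"
    using fix_between[of u z] z01 \<open>g z < z\<close> by auto
  moreover have "closed_segment u z \<subseteq> {p<..z}"
    using u by (auto simp: closed_segment_eq_real_ivl)
  ultimately show False using a(3) \<open>a = p\<close> by blast
qed

text \<open>If a point below \<open>p\<close> were mapped above \<open>p\<close>, then some point below \<open>p\<close> would be mapped just to the
right of \<open>p\<close> and would be attracted to a fixed point above \<open>p\<close>, through the barrier \<open>p\<close>.\<close>

lemma left_of_repelling:
  assumes p: "p \<in> fix_set g" and d: "d > 0" "p + d \<le> 1" "\<And>y. y \<in> {p<..p+d} \<Longrightarrow> g y > y"
    and y: "y \<in> {0..1}" "y \<le> p"
  shows "g y \<le> p"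
proof (rule ccontr)
  assume "\<not> g y \<le> p"
  have p01: "p \<in> {0..1}" "g p = p" using p by (auto simp: fix_set_def)
  define c where "c = min (g y) (p + d)"
  have c: "c \<in> {p<..p+d}" "c \<le> g y" using d \<open>\<not> g y \<le> p\<close> by (auto simp: c_def)
  then have c01: "c \<in> {0..1}" "g c > c" using d p01 by auto
  obtain b where b: "b \<in> fix_set g" "c < b" "{c..<b} \<inter> fix_set g = {}"
    using fix_above[OF c01] by blast
  have cb: "attracted_to g c b" by (rule attracted_next[OF c01 b])
  obtain z where z: "z \<in> closed_segment p y" "g z = c"
    using value_between[of p y c] p01 y c by auto
  then have "attracted_to g z b" using cb attracted_step[of g z b] by simp
  moreover have "z \<in> {0..1}" "z \<le> p"
    using z(1) y p01 by (auto simp: closed_segment_eq_real_ivl split: if_splits)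
  ultimately have "b \<le> p" using limit_le_fix p by blast
  then show False using b c by auto
qed

text \<open>By the two preceding lemmas and compactness, points below \<open>p\<close> are not mapped above \<open>p\<close>, and
points above \<open>r\<close> are not mapped below a certain level above \<open>p\<close>. Hence levels between \<open>p\<close> and
that one have a single preimage if they are below \<open>r\<close>; it lies in the collar again, because points of the collar
move up.\<close>

lemma collar_right:
  assumes p: "p \<in> fix_set g" and r: "p < r" "r \<le> 1" "strict_mono_on {p..r} g"
    and gt: "\<And>y. y \<in> {p<..r} \<Longrightarrow> g y > y"
  obtains e where "e > 0" "p + e \<le> r" "{p<..<p+e} \<subseteq> cut_core g"
proof -
  have p01: "p \<in> {0..1}" "g p = p" using p by (auto simp: fix_set_def)
  have gt': "\<And>y. y \<in> {p<..p + (r - p)} \<Longrightarrow> g y > y" using gt by simp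
  have "compact (g ` {r..1})" "g ` {r..1} \<noteq> {}"
    using p01 r by (auto intro!: compact_continuous_image cont_sub)
  from compact_attains_inf[OF this] obtain x where x: "x \<in> {r..1}" "\<And>y. y \<in> {r..1} \<Longrightarrow> g x \<le> g y"
    by auto
  have gx: "g x > p"
    by (rule right_of_repelling[OF p, where d = "r - p" and y = x]) (use gt' x r p01 in auto)
  define e where "e = min (g x - p) (r - p)"
  have e: "e > 0" "p + e \<le> r" "p + e \<le> g x" using gx r by (auto simp: e_def)
  have "cut_point g t" if "t \<in> {p<..<p+e}" for t
    using that
  proof (coinduction arbitrary: t)
    case cut_point
    then have t: "p < t" "t < p + e" by auto
    have "g r > t" using gt[of r] r t e by auto
    then obtain s where s: "s \<in> closed_segment p r" "g s = t"
      using value_between[of p r t] p01 r t by auto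
    then have s1: "p < s" "s \<le> r" using t p01 r by (auto simp: closed_segment_eq_real_ivl less_le)
    have s2: "s < p + e" using gt[of s] s1 s t by auto
    have "(y < s \<longrightarrow> g y < t) \<and> (s < y \<longrightarrow> t < g y)" if y: "y \<in> {0..1}" for y
    proof (intro conjI impI)
      assume "y < s"
      show "g y < t"
      proof (cases "y \<le> p")
        case True
        then have "g y \<le> p" using left_of_repelling[OF p, where d = "r - p" and y = y] gt' y r by auto
        then show ?thesis using t by simp
      next
        case False
        then show ?thesis using strict_mono_onD[OF r(3), of y s] s s1 \<open>y < s\<close> by auto
      qed
    next
      assume "s < y"
      show "t < g y"
      proof (cases "y \<le> r")
        case True
        then show ?thesis using strict_mono_onD[OF r(3), of s y] s s1 \<open>s < y\<close> by auto
      next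
        case False
        then show ?thesis using x(2)[of y] y t e by auto
      qed
    qed
    moreover have "s \<in> {p<..<p+e}" using s1 s2 by simp
    ultimately show ?case by blast
  qed
  then have "{p<..<p+e} \<subseteq> cut_core g" by (intro interior_maximal) auto
  then show thesis using that e by blast
qed

text \<open>A continuous function that is injective near \<open>p\<close> is strictly monotone there, and points
arbitrarily close to \<open>p\<close> that are mapped above \<open>p\<close> exclude the decreasing case.\<close>

lemma strict_mono_right:
  assumes p: "p \<in> fix_set g" "p < 1"
    and freq: "\<And>e. e > 0 \<Longrightarrow> \<exists>w\<in>{p<..<p+e}. w \<le> 1 \<and> g w > p"
  obtains r where "p < r" "r \<le> 1" "strict_mono_on {p..r} g"
proof -
  have p01: "p \<in> {0..1}" "g p = p" using p by (auto simp: fix_set_def)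
  obtain e where e: "e > 0" "p + e \<le> 1" "inj_on g {p..p+e}" using inj_right[OF p] by blast
  have c: "continuous_on {p..p+e} g" using p01 e by (intro cont_sub) auto
  obtain w where w: "w \<in> {p<..<p+e}" "g w > p" using freq[OF e(1)] by auto
  have "is_interval {p..p+e}" by (rule is_interval_cc)
  then have "strict_mono_on {p..p+e} g \<or> strict_antimono_on {p..p+e} g"
    using injective_eq_monotone_map[OF _ c] e(3) by blast
  moreover have "\<not> strict_antimono_on {p..p+e} g"
  proof
    assume "strict_antimono_on {p..p+e} g"
    then have "g w < g p" using w e by (auto simp: monotone_on_def)
    then show False using w p01 by simp
  qed
  ultimately show thesis using that[of "p+e"] e by auto
qed

lemma core_right_of_repelling:
  assumes p: "p \<in> fix_set g" and r: "p < r" "r \<le> 1" "\<And>y. y \<in> {p<..<r} \<Longrightarrow> g y > y"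
  obtains e where "e > 0" "p + e \<le> 1" "{p<..<p+e} \<subseteq> cut_core g"
proof -
  have "\<exists>w\<in>{p<..<p+e}. w \<le> 1 \<and> g w > p" if "e > 0" for e
  proof -
    define w where "w = min (p + e / 2) ((p + r) / 2)"
    have "w \<in> {p<..<p+e}" "w < r" using that r by (auto simp: w_def min_def field_simps)
    then show ?thesis using r(2) r(3)[of w] by (intro bexI[of _ w]) auto
  qed
  then obtain s where s: "p < s" "s \<le> 1" "strict_mono_on {p..s} g"
    using strict_mono_right p r by (metis less_le_trans)
  define t where "t = min s ((p + r) / 2)"
  have t: "p < t" "t \<le> 1" "t \<le> s" "t < r" using s r by (auto simp: t_def min_def field_simps)
  have "strict_mono_on {p..t} g"
    by (rule monotone_on_subset[OF s(3)]) (use t in auto)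
  then obtain e where "e > 0" "p + e \<le> t" "{p<..<p+e} \<subseteq> cut_core g"
    by (rule collar_right[OF p t(1,2)]) (use t r in auto)
  then show thesis using that t by auto
qed

lemma core_left_of_repelling:
  assumes p: "p \<in> fix_set g" and l: "l < p" "0 \<le> l" "\<And>y. y \<in> {l<..<p} \<Longrightarrow> g y < y"
  obtains e where "e > 0" "0 \<le> p - e" "{p-e<..<p} \<subseteq> cut_core g"
proof -
  obtain e where e: "e > 0" "1 - p + e \<le> 1" "{1-p<..<1-p+e} \<subseteq> cut_core (reflect g)"
  proof (rule attracting_map.core_right_of_repelling[OF reflect_attracting, of "1 - p" "1 - l"])
    fix y assume "y \<in> {1-p<..<1-l}"
    then show "y < reflect g y" using l(3)[of "1 - y"] by (auto simp: reflect_def)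
  qed (use assms in \<open>auto simp: fix_set_reflect\<close>)
  have "x \<in> cut_core g" if "x \<in> {p-e<..<p}" for x
  proof -
    have "1 - x \<in> {1-p<..<1-p+e}" using that by auto
    then have "1 - x \<in> cut_core (reflect g)" using e by blast
    then show ?thesis by (simp add: cut_core_reflect)
  qed
  then have "{p-e<..<p} \<subseteq> cut_core g" by blast
  then show thesis using that e by auto
qed

text \<open>Otherwise some \<open>z\<close> below \<open>p\<close> would be mapped to \<open>t\<close>, and \<open>z\<close> would be attracted to \<open>t\<close> through the barrier \<open>p\<close>.\<close>

lemma below_fixed_interval:
  assumes "t \<in> {p<..<q}" "{p..q} \<subseteq> fix_set g" "y \<in> {0..1}" "y < t"
  shows "g y < t"
proof (rule ccontr)
  assume "\<not> g y < t"
  have t01: "t \<in> {0..1}" "g t = t" and p01: "p \<in> {0..1}" "p \<in> fix_set g" "g p = p"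
    using assms(1,2) by (auto simp: fix_set_def subset_iff)
  have "y < p"
  proof (rule ccontr)
    assume "\<not> y < p"
    then have "y \<in> fix_set g" using assms by auto
    then show False using \<open>\<not> g y < t\<close> assms(4) by (auto simp: fix_set_def)
  qed
  obtain z where z: "z \<in> closed_segment p y" "g z = t"
    using value_between[of p y t] p01 assms \<open>\<not> g y < t\<close> by auto
  then have z': "z \<le> p" "z \<in> {0..1}"
    using \<open>y < p\<close> assms(3) p01 by (auto simp: closed_segment_eq_real_ivl split: if_splits)
  have "attracted_to g z t"
    using attracted_step[of g z t] attracted_fixed[of g t] z t01 by simp
  then have "t \<le> p" using limit_le_fix[of z p t] z' p01 by blast
  then show False using assms by simp
qed

lemma core_fixed_interval:
  assumes "{p..q} \<subseteq> fix_set g"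
  shows "{p<..<q} \<subseteq> cut_core g"
proof -
  have "t < g y" if t: "t \<in> {p<..<q}" and y: "y \<in> {0..1}" "t < y" for t y
  proof -
    have "u \<in> fix_set (reflect g)" if "u \<in> {1-q..1-p}" for u
    proof -
      have "1 - u \<in> {p..q}" using that by auto
      then show ?thesis using assms by (auto simp: fix_set_reflect)
    qed
    then have "reflect g (1 - y) < 1 - t"
      by (intro attracting_map.below_fixed_interval[OF reflect_attracting, of "1 - t" "1 - q" "1 - p"])
        (use t y in auto)
    then show ?thesis by (simp add: reflect_def)
  qed
  moreover have "g y < t" if "t \<in> {p<..<q}" "y \<in> {0..1}" "y < t" for t y
    using below_fixed_interval that assms by blast
  ultimately have "cut_point g t" if "t \<in> {p<..<q}" for t
    using that by (coinduction arbitrary: t) blast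
  then show ?thesis by (intro interior_maximal) auto
qed

text \<open>Either the interval consists of fixed points, which are then their own preimages as cut points, or
it contains a component of the complement of the fixed points, one end of which is repelling.\<close>

lemma core_between_fixed:
  assumes "p \<in> fix_set g" "q \<in> fix_set g" "p < q"
  obtains u v where "u < v" "{u<..<v} \<subseteq> {p<..<q} \<inter> cut_core g"
proof (cases "{p..q} \<subseteq> fix_set g")
  case True
  then show thesis using that[OF assms(3)] core_fixed_interval by auto
next
  case False
  have pq: "p \<in> {0..1}" "q \<in> {0..1}" using assms by (auto simp: fix_set_def)
  obtain y where y: "y \<in> {p..q}" "y \<notin> fix_set g" using False by blast
  have y01: "y \<in> {0..1}" using y pq by auto
  obtain a where a: "a \<in> fix_set g" "a \<le> y" "p \<le> a" "{a<..y} \<inter> fix_set g = {}"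
    using y assms by (auto intro: nearest_fix_below[of p y])
  obtain b where b: "b \<in> fix_set g" "y \<le> b" "b \<le> q" "{y..<b} \<inter> fix_set g = {}"
    using y assms by (auto intro: nearest_fix_above[of q y])
  have ab: "a < y" "y < b" "a \<in> {0..1}" "b \<in> {0..1}"
    using a b y by (auto simp: less_le fix_set_def)
  have free: "closed_segment y z \<inter> fix_set g = {}" if "z \<in> {a<..<b}" for z
  proof -
    have "closed_segment y z \<subseteq> {a<..y} \<union> {y..<b}"
      using that ab by (auto simp: closed_segment_eq_real_ivl split: if_splits)
    then show ?thesis using a b by blast
  qed
  have "g y \<noteq> y" using y y01 by (auto simp: fix_set_def)
  then consider "g y > y" | "g y < y" by linarith
  then show thesis
  proof cases
    case 1
    have gt: "g z > z" if "z \<in> {a<..<b}" for z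
      using gt_on_segment[OF y01 _ 1 free[OF that]] that ab by auto
    obtain e where e: "e > 0" "a + e \<le> 1" "{a<..<a+e} \<subseteq> cut_core g"
      using core_right_of_repelling[OF a(1), of b] gt ab by auto
    show thesis using that[of a "min (a + e) b"] e ab a b by (auto simp: subset_iff)
  next
    case 2
    have lt: "g z < z" if z: "z \<in> {a<..<b}" for z
    proof (rule ccontr)
      assume "\<not> g z < z"
      then have "\<exists>p\<in>closed_segment z y. p \<in> fix_set g"
        using fix_between[of z y] z ab y01 2 by auto
      then show False using free[OF z] by (auto simp: closed_segment_commute)
    qed
    obtain e where e: "e > 0" "0 \<le> b - e" "{b-e<..<b} \<subseteq> cut_core g"
      using core_left_of_repelling[OF b(1), of a] lt ab by auto
    show thesis using that[of "max (b - e) a" b] e ab a b by (auto simp: subset_iff)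
  qed
qed

section \<open>Backward orbits under the attraction property\<close>

text \<open>Earlier terms of the sequence are later points of an orbit, so \<open>iterate_gt\<close> compares them with later terms.\<close>

lemma backward_gt:
  assumes "\<And>n. x n \<in> {0..1}" "\<And>n. g (x (Suc n)) = x n" "n < m"
  shows "g (x m) > x m \<Longrightarrow> x n > x m" "g (x m) < x m \<Longrightarrow> x n < x m"
proof -
  have "(g ^^ (m - n)) (x m) = x n"
    using backward_iterate[of g x "m - n" n] assms by simp
  then show "g (x m) > x m \<Longrightarrow> x n > x m" "g (x m) < x m \<Longrightarrow> x n < x m"
    using iterate_gt[of "x m" "m - n"] iterate_lt[of "x m" "m - n"] assms by auto
qed

text \<open>Such a sequence decreases to a fixed point \<open>p\<close>, and \<open>g\<close> is increasing to the right of \<open>p\<close>. A fixed point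
close to \<open>p\<close> on the right would bound all later terms from below; hence there is none, \<open>p\<close> repels on the right, and
the sequence enters the collar.\<close>

lemma backward_eventually_in_core_decreasing:
  assumes x: "\<And>n. x n \<in> {0..1}" "\<And>n. g (x (Suc n)) = x n"
    and N: "\<And>n. n \<ge> N \<Longrightarrow> g (x n) > x n"
  shows "\<forall>\<^sub>F n in sequentially. x n \<in> cut_core g"
proof -
  have dec: "x (Suc n) < x n" if "n \<ge> N" for n
    using N[of "Suc n"] x(2)[of n] that by simp
  define s where "s n = x (n + N)" for n
  have s: "s n \<in> {0..1}" "g (s (Suc n)) = s n" "s (Suc n) < s n" for n
    using x dec by (auto simp: s_def)
  have decs: "decseq s" by (rule decseq_SucI) (rule less_imp_le[OF s(3)])
  then obtain p where p: "s \<longlonglongrightarrow> p"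
    by (rule decseq_convergent[of s 0]) (use s(1) in auto)
  have pfix: "p \<in> fix_set g" using limit_is_fixed[of s p] s p by auto
  have "p \<le> s n" for n using decseq_ge[OF decs p] by simp
  then have sp: "p < s n" for n using s(3)[of n] le_less_trans by blast
  have "p < 1" using sp[of 0] s(1)[of 0] by auto
  have small: "\<forall>\<^sub>F n in sequentially. s n < p + e" if "e > 0" for e
    using order_tendstoD(2)[OF p] that by simp
  have "\<exists>w\<in>{p<..<p+e}. w \<le> 1 \<and> g w > p" if e: "e > 0" for e
  proof -
    obtain n where n: "s n < p + e" using small[OF e] by (auto simp: eventually_sequentially)
    have "s (Suc n) \<in> {p<..<p+e}" "s (Suc n) \<le> 1" "g (s (Suc n)) > p"
      using n s[of n] s(1)[of "Suc n"] sp by (auto intro: less_trans)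
    then show ?thesis by blast
  qed
  then obtain r where r: "p < r" "r \<le> 1" "strict_mono_on {p..r} g"
    using strict_mono_right[OF pfix \<open>p < 1\<close>] by blast
  obtain M where M: "s M < r" using small[of "r - p"] r by (auto simp: eventually_sequentially)
  have sM01: "s (Suc M) \<in> {0..1}" "s (Suc M) < s M" "g (s (Suc M)) = s M" using s by auto
  have nofix: "z \<notin> fix_set g" if z: "z \<in> {p<..s (Suc M)}" for z
  proof
    assume "z \<in> fix_set g"
    then have zz: "g z = z" by (simp add: fix_set_def)
    have "s (M + n) \<ge> z" for n
    proof (induction n)
      case 0
      then show ?case using z sM01 by simp
    next
      case (Suc n)
      show ?case
      proof (rule ccontr)
        assume "\<not> z \<le> s (M + Suc n)"
        then have "g (s (M + Suc n)) < g z"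
          using strict_mono_onD[OF r(3), of "s (M + Suc n)" z] sp[of "M + Suc n"] z M sM01 by auto
        then show False using zz Suc s(2)[of "M + n"] by simp
      qed
    qed
    moreover have "(\<lambda>n. s (n + M)) \<longlonglongrightarrow> p" using p by (rule LIMSEQ_ignore_initial_segment)
    ultimately have "z \<le> p" by (intro LIMSEQ_le_const[of "\<lambda>n. s (n + M)"]) (auto simp: add.commute)
    then show False using z by simp
  qed
  have gt: "g y > y" if y: "y \<in> {p<..<s (Suc M)}" for y
  proof (rule gt_on_segment[of "s (Suc M)"])
    have "closed_segment (s (Suc M)) y \<subseteq> {p<..s (Suc M)}"
      using y by (auto simp: closed_segment_eq_real_ivl split: if_splits)
    then show "closed_segment (s (Suc M)) y \<inter> fix_set g = {}" using nofix by blast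
  qed (use y sM01 pfix in \<open>auto simp: fix_set_def\<close>)
  obtain e where e: "e > 0" "p + e \<le> 1" "{p<..<p+e} \<subseteq> cut_core g"
    by (rule core_right_of_repelling[OF pfix, of "s (Suc M)"]) (use gt sp sM01 in auto)
  have "\<forall>\<^sub>F n in sequentially. s n \<in> cut_core g"
    using small[OF e(1)] by eventually_elim (use sp e(3) in auto)
  then show ?thesis unfolding s_def by (rule eventually_sequentially_seg[THEN iffD1])
qed

lemma backward_eventually_in_core_increasing:
  assumes x: "\<And>n. x n \<in> {0..1}" "\<And>n. g (x (Suc n)) = x n"
    and N: "\<And>n. n \<ge> N \<Longrightarrow> g (x n) < x n"
  shows "\<forall>\<^sub>F n in sequentially. x n \<in> cut_core g"
proof -
  have "\<forall>\<^sub>F n in sequentially. 1 - x n \<in> cut_core (reflect g)"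
    by (rule attracting_map.backward_eventually_in_core_decreasing[OF reflect_attracting, of _ N])
      (use assms in \<open>auto simp: reflect_def\<close>)
  then show ?thesis by (simp add: cut_core_reflect)
qed

text \<open>Evaluated along the indices at which the sequence passes from \<open>P\<close> to \<open>Q\<close>.\<close>

lemma switching_limit:
  assumes x: "\<And>n. x n \<in> {0..1}" "\<And>n. g (x (Suc n)) = x n"
    and a: "(x \<longlongrightarrow> a) (inf sequentially (principal (Collect P)))"
    and b: "(x \<longlongrightarrow> b) (inf sequentially (principal (Collect Q)))" "b \<in> {0..1}"
    and freq: "\<exists>\<^sub>F n in sequentially. P n \<and> Q (Suc n)"
  shows "g b = a"
proof -
  define F where "F = inf sequentially (principal {n. P n \<and> Q (Suc n)})"
  have "F \<noteq> bot"
    using freq by (auto simp: F_def trivial_limit_def frequently_def eventually_inf_principal)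
  have "F \<le> inf sequentially (principal (Collect P))"
    unfolding F_def by (intro inf_mono) auto
  then have a': "(x \<longlongrightarrow> a) F" using a by (rule tendsto_mono)
  have "filterlim Suc (inf sequentially (principal (Collect Q))) F"
    unfolding filterlim_inf
  proof
    show "filterlim Suc sequentially F"
      unfolding F_def by (rule filterlim_mono[OF filterlim_Suc]) auto
    show "filterlim Suc (principal (Collect Q)) F"
      by (auto simp: F_def filterlim_principal eventually_inf_principal)
  qed
  then have "((\<lambda>n. x (Suc n)) \<longlongrightarrow> b) F" by (rule filterlim_compose[OF b(1)])
  then have "((\<lambda>n. g (x (Suc n))) \<longlongrightarrow> g b) F"
    by (rule continuous_on_tendsto_compose[OF cont]) (use b(2) x(1) in auto)
  then show ?thesis using a' tendsto_unique[OF \<open>F \<noteq> bot\<close>] by (simp add: x(2))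
qed

text \<open>By \<open>backward_gt\<close> the terms that move up decrease to a limit \<open>a\<close>, the terms that move down increase
to a limit \<open>b\<close>, and the former all lie below the latter. If both kinds occurred infinitely often, continuity
would give \<open>g b = a\<close> and \<open>g a = b\<close>, a cycle of period two.\<close>

lemma backward_no_switching:
  assumes x: "\<And>n. x n \<in> {0..1}" "\<And>n. g (x (Suc n)) = x n"
    and A: "\<exists>\<^sub>F n in sequentially. g (x n) > x n"
    and B: "\<exists>\<^sub>F n in sequentially. g (x n) < x n"
  shows False
proof -
  define P where "P n \<longleftrightarrow> g (x n) > x n" for n
  define Q where "Q n \<longleftrightarrow> g (x n) < x n" for n
  define a where "a = Inf (x ` Collect P)"
  define b where "b = Sup (x ` Collect Q)"
  have PQ: "\<exists>\<^sub>F n in sequentially. P n" "\<exists>\<^sub>F n in sequentially. Q n"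
    using A B by (auto simp: P_def Q_def)
  have ne: "x ` Collect P \<noteq> {}" "x ` Collect Q \<noteq> {}"
    using PQ by (auto simp: frequently_sequentially)
  have bdd: "bdd_below (x ` Collect P)" "bdd_above (x ` Collect Q)"
    using x(1) by (auto intro!: bdd_belowI[of _ 0] bdd_aboveI[of _ 1])
  have a_le: "a \<le> x n" if "P n" for n
    unfolding a_def using bdd that by (auto intro!: cInf_lower)
  have le_b: "x n \<le> b" if "Q n" for n
    unfolding b_def using bdd that by (auto intro!: cSup_upper)
  have ab01: "a \<in> {0..1}" "b \<in> {0..1}"
  proof -
    have "0 \<le> a" "b \<le> 1" unfolding a_def b_def
      using ne x(1) by (auto intro!: cInf_greatest cSup_least)
    moreover obtain n m where "P n" "Q m" using ne by auto
    ultimately show "a \<in> {0..1}" "b \<in> {0..1}"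
      using a_le[of n] le_b[of m] x(1)[of n] x(1)[of m] by auto
  qed
  have lima: "(x \<longlongrightarrow> a) (inf sequentially (principal (Collect P)))"
  proof (rule order_tendstoI)
    fix c assume "c < a"
    then have "P n \<Longrightarrow> c < x n" for n using a_le[of n] by simp
    then show "\<forall>\<^sub>F n in inf sequentially (principal (Collect P)). c < x n"
      by (simp add: eventually_inf_principal)
  next
    fix c assume "a < c"
    then obtain m where m: "P m" "x m < c" using ne bdd by (auto simp: a_def cInf_less_iff)
    have "\<forall>\<^sub>F n in sequentially. P n \<longrightarrow> x n < c"
      using eventually_gt_at_top[of m]
    proof eventually_elim
      case (elim n)
      then show ?case using backward_gt(1)[of x m n, OF x] m by (auto simp: P_def)
    qed
    then show "\<forall>\<^sub>F n in inf sequentially (principal (Collect P)). x n < c"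
      by (simp add: eventually_inf_principal)
  qed
  have limb: "(x \<longlongrightarrow> b) (inf sequentially (principal (Collect Q)))"
  proof (rule order_tendstoI)
    fix c assume "b < c"
    then have "Q n \<Longrightarrow> x n < c" for n using le_b[of n] by simp
    then show "\<forall>\<^sub>F n in inf sequentially (principal (Collect Q)). x n < c"
      by (simp add: eventually_inf_principal)
  next
    fix c assume "c < b"
    then obtain m where m: "Q m" "c < x m" using ne bdd by (auto simp: b_def less_cSup_iff)
    have "\<forall>\<^sub>F n in sequentially. Q n \<longrightarrow> c < x n"
      using eventually_gt_at_top[of m]
    proof eventually_elim
      case (elim n)
      then show ?case using backward_gt(2)[of x m n, OF x] m by (auto simp: Q_def)
    qed
    then show "\<forall>\<^sub>F n in inf sequentially (principal (Collect Q)). c < x n"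
      by (simp add: eventually_inf_principal)
  qed
  obtain n where n: "P n" using ne by auto
  have nonfix: "g (x (n + k)) \<noteq> x (n + k)" for k
  proof (induction k)
    case (Suc k)
    then show ?case using x(2)[of "n + k"] by auto
  qed (use n in \<open>simp add: P_def\<close>)
  have ev: "P m \<or> Q m" if "m \<ge> n" for m
    using nonfix[of "m - n"] that by (auto simp: P_def Q_def)
  have ev1: "\<forall>\<^sub>F n in sequentially. P n \<or> Q n" "\<forall>\<^sub>F n in sequentially. Q n \<or> P n"
    using ev by (auto simp: eventually_sequentially)
  have "g b = a"
    by (rule switching_limit[of x a P b Q, OF x lima limb ab01(2) frequently_switch[OF PQ ev1(1)]])
  moreover have "g a = b"
    by (rule switching_limit[of x b Q a P, OF x limb lima ab01(1) frequently_switch[OF PQ(2,1) ev1(2)]])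
  ultimately have "g a = a"
    using periodic_fixed[of a 2] ab01 by (simp add: numeral_2_eq_2)
  then have "a = b" using \<open>g a = b\<close> by simp
  obtain m where m: "m > n" "Q m" using PQ(2) by (auto simp: frequently_sequentially Suc_le_eq[symmetric])
  have "x n < x m" using backward_gt(2)[of x n m, OF x m(1)] m(2) by (simp add: Q_def)
  then show False using a_le[OF n] le_b[OF m(2)] \<open>a = b\<close> by simp
qed

lemma backward_eventually:
  assumes x: "\<And>n. x n \<in> {0..1}" "\<And>n. g (x (Suc n)) = x n"
  shows "\<forall>\<^sub>F n in sequentially. x n \<in> fix_set g \<union> cut_core g"
proof -
  consider "\<forall>n. g (x n) = x n" | m where "g (x m) \<noteq> x m" by blast
  then show ?thesis
  proof cases
    case 1
    then show ?thesis using x(1) by (auto simp: fix_set_def)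
  next
    case (2 m)
    have nonfix: "g (x (m + k)) \<noteq> x (m + k)" for k
    proof (induction k)
      case (Suc k)
      then show ?case using x(2)[of "m + k"] by auto
    qed (use 2 in simp)
    have nf: "g (x n) \<noteq> x n" if "n \<ge> m" for n using nonfix[of "n - m"] that by simp
    have "\<not> (\<exists>\<^sub>F n in sequentially. g (x n) > x n) \<or> \<not> (\<exists>\<^sub>F n in sequentially. g (x n) < x n)"
      using backward_no_switching[of x, OF x] by blast
    then obtain K where "(\<forall>n\<ge>K. \<not> g (x n) > x n) \<or> (\<forall>n\<ge>K. \<not> g (x n) < x n)"
      by (auto simp: frequently_def eventually_sequentially)
    then consider "\<And>n. n \<ge> max m K \<Longrightarrow> g (x n) > x n" | "\<And>n. n \<ge> max m K \<Longrightarrow> g (x n) < x n"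
      using nf by (metis linorder_neqE max.bounded_iff)
    then have "\<forall>\<^sub>F n in sequentially. x n \<in> cut_core g"
    proof cases
      case 1
      then show ?thesis by (rule backward_eventually_in_core_decreasing[of x, OF x])
    next
      case 2
      then show ?thesis by (rule backward_eventually_in_core_increasing[of x, OF x])
    qed
    then show ?thesis by (rule eventually_mono) auto
  qed
qed

end

section \<open>A continuous injection into the line\<close>

text \<open>The interior is taken so that the measured set is Borel; the dynamics provides whole intervals
of cut points, so nothing is lost.\<close>

definition core_mass :: "(real \<Rightarrow> real) \<Rightarrow> real \<Rightarrow> real" where
  "core_mass g x = measure lborel (cut_core g \<inter> {0..x})"

lemma core_mass_diff:
  assumes "x \<le> y"
  shows "core_mass g y - core_mass g x = measure lborel (cut_core g \<inter> {0..y} - {0..x})"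
proof -
  have "emeasure lborel (cut_core g \<inter> {0..y}) \<le> emeasure lborel {0..y}"
    by (intro emeasure_mono) auto
  also have "\<dots> < \<infinity>" by (simp add: emeasure_lborel_Icc_eq)
  finally have "emeasure lborel (cut_core g \<inter> {0..y}) \<noteq> \<infinity>" by simp
  then have "measure lborel (cut_core g \<inter> {0..y} - (cut_core g \<inter> {0..x}))
      = core_mass g y - core_mass g x"
    unfolding core_mass_def using assms by (intro measure_Diff) auto
  moreover have "cut_core g \<inter> {0..y} - (cut_core g \<inter> {0..x}) = cut_core g \<inter> {0..y} - {0..x}"
    by auto
  ultimately show ?thesis by simp
qed

lemma core_mass_mono: "x \<le> y \<Longrightarrow> core_mass g x \<le> core_mass g y"
  using core_mass_diff[of x y g] measure_nonneg[of lborel "cut_core g \<inter> {0..y} - {0..x}"] by linarith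

lemma core_mass_lipschitz:
  assumes "0 \<le> x" "x \<le> y"
  shows "core_mass g y - core_mass g x \<le> y - x"
proof -
  have "measure lborel (cut_core g \<inter> {0..y} - {0..x}) \<le> measure lborel {x..y}"
    by (rule measure_mono_fmeasurable) (auto intro: fmeasurable_compact)
  then show ?thesis using core_mass_diff[OF assms(2), of g] assms by simp
qed

lemma core_mass_0: "core_mass g 0 = 0"
proof -
  have "core_mass g 0 \<le> measure lborel {0..0::real}"
    unfolding core_mass_def by (rule measure_mono_fmeasurable) (auto intro: fmeasurable_compact)
  then show ?thesis by (simp add: core_mass_def antisym)
qed

lemma core_mass_bounds: "x \<in> {0..1} \<Longrightarrow> core_mass g x \<in> {0..1}"
  using core_mass_lipschitz[of 0 x g] core_mass_mono[of 0 x g] by (simp add: core_mass_0)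

lemma core_mass_less:
  assumes "0 \<le> x" "x \<le> u" "u < v" "v \<le> y" "{u<..<v} \<subseteq> cut_core g"
  shows "core_mass g x < core_mass g y"
proof -
  have "measure lborel {u<..<v} \<le> measure lborel (cut_core g \<inter> {0..y} - {0..x})"
  proof (rule measure_mono_fmeasurable)
    have "cut_core g \<inter> {0..y} - {0..x} \<in> sets lborel" by simp
    then show "cut_core g \<inter> {0..y} - {0..x} \<in> fmeasurable lborel"
      by (rule fmeasurableI2[of "{0..y}", rotated 2]) (auto intro: fmeasurable_compact)
    show "{u<..<v} \<subseteq> cut_core g \<inter> {0..y} - {0..x}"
      using assms by (auto simp: subset_iff)
  qed simp
  then show ?thesis using core_mass_diff[of x y g] assms by simp
qed

text \<open>This converse makes comparisons of mass usable: a strict inequality exhibits an actual cut point,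
which can then be pulled back to deeper coordinates.\<close>

lemma core_mass_less_imp:
  assumes "core_mass g x < core_mass g y"
  shows "x < y" "\<exists>t\<in>{x<..<y}. cut_point g t"
proof -
  show xy: "x < y" using core_mass_mono[of y x g] assms by linarith
  show "\<exists>t\<in>{x<..<y}. cut_point g t"
  proof (rule ccontr)
    assume no: "\<not> ?thesis"
    have "cut_core g \<inter> {x<..y} = {}"
    proof (rule ccontr)
      assume "cut_core g \<inter> {x<..y} \<noteq> {}"
      then obtain t where t: "t \<in> cut_core g" "x < t" "t \<le> y" by auto
      then obtain e where e: "e > 0" "\<And>u. \<bar>u - t\<bar> < e \<Longrightarrow> cut_point g u"
        by (auto simp: cut_core_iff)
      define u where "u = max (t - e / 2) ((x + t) / 2)"
      have "u \<in> {x<..<y}" "\<bar>u - t\<bar> < e" using t e(1) by (auto simp: u_def max_def field_simps)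
      then show False using no e(2) by blast
    qed
    moreover have "cut_core g \<inter> {0..y} - {0..x} \<subseteq> cut_core g \<inter> {x<..y}" by auto
    ultimately have "cut_core g \<inter> {0..y} - {0..x} = {}" by blast
    then have "core_mass g y - core_mass g x = 0"
      unfolding core_mass_diff[OF less_imp_le[OF xy]] by (metis measure_empty)
    then show False using assms by simp
  qed
qed

lemma continuous_core_mass: "continuous_on {0..1} (core_mass g)"
proof -
  have "\<bar>core_mass g x - core_mass g y\<bar> \<le> 1 * \<bar>x - y\<bar>" if "x \<in> {0..1}" "y \<in> {0..1}" for x y
    using core_mass_lipschitz[of x y g] core_mass_lipschitz[of y x g]
      core_mass_mono[of x y g] core_mass_mono[of y x g] that by (cases "x \<le> y") auto
  then have "1-lipschitz_on {0..1} (core_mass g)" by (intro lipschitz_onI) (auto simp: dist_real_def)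
  then show ?thesis by (rule lipschitz_on_continuous_on)
qed

lemma cut_point_pullback:
  assumes "g ` {0..1} \<subseteq> {0..1}" "cut_point g t"
  shows "\<exists>s. \<forall>y\<in>{0..1}. (y < s \<longrightarrow> (g ^^ n) y < t) \<and> (s < y \<longrightarrow> t < (g ^^ n) y)"
  using assms(2)
proof (induction n arbitrary: t)
  case 0
  then show ?case by auto
next
  case (Suc n)
  from Suc.prems obtain s where s: "cut_point g s"
    "\<forall>y\<in>{0..1}. (y < s \<longrightarrow> g y < t) \<and> (s < y \<longrightarrow> t < g y)"
    by (auto elim: cut_point.cases)
  obtain r where r: "\<forall>y\<in>{0..1}. (y < r \<longrightarrow> (g ^^ n) y < s) \<and> (r < y \<longrightarrow> s < (g ^^ n) y)"
    using Suc.IH[OF s(1)] by auto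
  have "(g ^^ n) y \<in> {0..1}" if "y \<in> {0..1}" for y
    by (induction n) (use assms(1) that in \<open>auto simp: image_subset_iff\<close>)
  then show ?case using r s(2) by (intro exI[of _ r]) auto
qed

lemma cut_separates_later:
  assumes "g ` {0..1} \<subseteq> {0..1}"
    and x: "\<And>n. x n \<in> {0..1}" "\<And>n. g (x (Suc n)) = x n"
    and y: "\<And>n. y n \<in> {0..1}" "\<And>n. g (y (Suc n)) = y n"
    and t: "cut_point g t" "x n < t" "t < y n" and "n \<le> m"
  shows "x m \<le> y m"
proof -
  obtain s where s: "\<And>u. u \<in> {0..1} \<Longrightarrow> (u < s \<longrightarrow> (g ^^ (m - n)) u < t) \<and> (s < u \<longrightarrow> t < (g ^^ (m - n)) u)"
    using cut_point_pullback[OF assms(1) t(1)] by blast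
  have "(g ^^ (m - n)) (x m) = x n" "(g ^^ (m - n)) (y m) = y n"
    using backward_iterate[of g x "m - n" n] backward_iterate[of g y "m - n" n] x y \<open>n \<le> m\<close>
    by auto
  then have "x m \<le> s" "s \<le> y m" using s[of "x m"] s[of "y m"] x(1) y(1) t by fastforce+
  then show ?thesis by simp
qed

text \<open>The order of two backward orbits does not depend on the coordinate at which it is read off. If two
coordinates gave opposite answers, the cut point seen at the smaller index could be pulled back to
the larger index, where it contradicts the other cut.\<close>

lemma core_mass_comparison:
  assumes g: "g ` {0..1} \<subseteq> {0..1}"
    and x: "\<And>n. x n \<in> {0..1}" "\<And>n. g (x (Suc n)) = x n"
    and y: "\<And>n. y n \<in> {0..1}" "\<And>n. g (y (Suc n)) = y n"
    and less: "core_mass g (x n) < core_mass g (y n)"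
  shows "core_mass g (x m) \<le> core_mass g (y m)"
proof (rule ccontr)
  assume "\<not> ?thesis"
  then have less': "core_mass g (y m) < core_mass g (x m)" by simp
  obtain t where t: "t \<in> {x n<..<y n}" "cut_point g t" using core_mass_less_imp(2)[OF less] by auto
  obtain u where u: "u \<in> {y m<..<x m}" "cut_point g u" using core_mass_less_imp(2)[OF less'] by auto
  show False
  proof (cases "n \<le> m")
    case True
    then have "x m \<le> y m" using cut_separates_later[of g x y t n m, OF g x y] t by auto
    then show False using u by auto
  next
    case False
    then have "y n \<le> x n" using cut_separates_later[of g y x u m n, OF g y x] u by auto
    then show False using t by auto
  qed
qed

definition height :: "(real \<Rightarrow> real) \<Rightarrow> (nat \<Rightarrow> real) \<Rightarrow> real" where
  "height g x = (\<Sum>n. (1 / 2) ^ n * core_mass g (x n))"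

lemma summable_height:
  assumes "\<And>n. x n \<in> {0..1}"
  shows "summable (\<lambda>n. (1 / 2) ^ n * core_mass g (x n))"
proof (rule summable_comparison_test')
  show "summable (\<lambda>n. (1 / 2) ^ n :: real)" by (rule summable_geometric) simp
  show "norm ((1 / 2) ^ n * core_mass g (x n)) \<le> (1 / 2) ^ n" for n
    using core_mass_bounds[OF assms, of g n] by (auto simp: abs_mult intro: mult_left_le)
qed

lemma height_less:
  assumes g: "g ` {0..1} \<subseteq> {0..1}"
    and x: "\<And>n. x n \<in> {0..1}" "\<And>n. g (x (Suc n)) = x n"
    and y: "\<And>n. y n \<in> {0..1}" "\<And>n. g (y (Suc n)) = y n"
    and less: "core_mass g (x n) < core_mass g (y n)"
  shows "height g x < height g y"
proof -
  let ?d = "\<lambda>n. (1 / 2) ^ n * core_mass g (y n) - (1 / 2) ^ n * core_mass g (x n)"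
  note sum = summable_height[of x g, OF x(1)] summable_height[of y g, OF y(1)]
  have "0 < suminf ?d"
  proof (rule suminf_pos2)
    show "summable ?d" by (rule summable_diff[OF sum(2,1)])
    show "0 \<le> ?d m" for m
      using core_mass_comparison[of g x y n m, OF g x y less] by simp
    show "0 < ?d n" using less by simp
  qed
  then show ?thesis using suminf_diff[OF sum(2,1)] by (simp add: height_def)
qed

context attracting_map
begin

text \<open>The terms of a backward orbit are finally of the kind considered here, so distinct backward
orbits are told apart by \<open>core_mass\<close> at a deep coordinate.\<close>

lemma core_mass_strict:
  assumes ab: "a \<in> {0..1}" "b \<in> {0..1}" "a < b"
    and a: "a \<in> fix_set g \<union> cut_core g" and b: "b \<in> fix_set g \<union> cut_core g"
  shows "core_mass g a < core_mass g b"
proof -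
  consider "a \<in> cut_core g" | "b \<in> cut_core g" | "a \<in> fix_set g" "b \<in> fix_set g"
    using a b by auto
  then obtain u v where uv: "u < v" "a \<le> u" "v \<le> b" "{u<..<v} \<subseteq> cut_core g"
  proof cases
    case 1
    then obtain e where e: "e > 0" "ball a e \<subseteq> cut_core g"
      using open_contains_ball[of "cut_core g"] by auto
    have "{a<..<min b (a + e)} \<subseteq> ball a e" by (auto simp: dist_real_def)
    then show ?thesis using that[of a "min b (a + e)"] e ab by auto
  next
    case 2
    then obtain e where e: "e > 0" "ball b e \<subseteq> cut_core g"
      using open_contains_ball[of "cut_core g"] by auto
    have "{max a (b - e)<..<b} \<subseteq> ball b e" by (auto simp: dist_real_def)
    then show ?thesis using that[of "max a (b - e)" b] e ab by auto
  next
    case 3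
    then obtain u v where uv: "u < v" "{u<..<v} \<subseteq> {a<..<b} \<inter> cut_core g"
      using core_between_fixed ab(3) by blast
    have "{u..v} = closure {u<..<v}" using uv by simp
    also have "\<dots> \<subseteq> closure {a<..<b}" using uv by (intro closure_mono) auto
    also have "\<dots> = {a..b}" using ab by simp
    finally show ?thesis using that[of u v] uv by auto
  qed
  show ?thesis using core_mass_less[of a u v b g] uv ab by auto
qed

lemma height_inj:
  assumes x: "\<And>n. x n \<in> {0..1}" "\<And>n. g (x (Suc n)) = x n"
    and y: "\<And>n. y n \<in> {0..1}" "\<And>n. g (y (Suc n)) = y n"
    and eq: "height g x = height g y"
  shows "x = y"
proof (rule ccontr)
  assume "x \<noteq> y"
  then obtain k where k: "x k \<noteq> y k" by auto
  have ne: "x (k + i) \<noteq> y (k + i)" for i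
  proof (induction i)
    case (Suc i)
    then show ?case using x(2)[of "k + i"] y(2)[of "k + i"] by auto
  qed (use k in simp)
  have "\<forall>\<^sub>F n in sequentially. x n \<in> fix_set g \<union> cut_core g \<and> y n \<in> fix_set g \<union> cut_core g"
    by (rule eventually_conj[OF backward_eventually[of x, OF x] backward_eventually[of y, OF y]])
  then obtain N where N: "\<And>n. n \<ge> N \<Longrightarrow> x n \<in> fix_set g \<union> cut_core g \<and> y n \<in> fix_set g \<union> cut_core g"
    unfolding eventually_sequentially by blast
  have N': "x (k + N) \<in> fix_set g \<union> cut_core g" "y (k + N) \<in> fix_set g \<union> cut_core g"
    using N[of "k + N"] by simp_all
  have g: "g ` {0..1} \<subseteq> {0..1}" using onto by simp
  consider "x (k + N) < y (k + N)" | "y (k + N) < x (k + N)" using ne[of N] by linarith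
  then show False
  proof cases
    case 1
    then have "core_mass g (x (k + N)) < core_mass g (y (k + N))"
      using core_mass_strict x(1) y(1) N' by blast
    then show False using height_less[of g x y, OF g x y] eq by auto
  next
    case 2
    then have "core_mass g (y (k + N)) < core_mass g (x (k + N))"
      using core_mass_strict x(1) y(1) N' by blast
    then show False using height_less[of g y x, OF g y x] eq by auto
  qed
qed

end

section \<open>Topology of the inverse limit\<close>

lemma continuous_on_coordinate: "continuous_on S (\<lambda>x. x i :: real)"
  by (rule continuous_on_subset[OF continuous_on_product_coordinates]) simp

lemma continuous_height:
  assumes "\<And>z n. z \<in> X \<Longrightarrow> e z n \<in> {0..1}" "\<And>n. continuous_on X (\<lambda>z. e z n)"
  shows "continuous_on X (\<lambda>z. height g (e z))"
proof -
  have "uniform_limit X (\<lambda>n z. \<Sum>i<n. (1 / 2) ^ i * core_mass g (e z i)) (\<lambda>z. height g (e z)) sequentially"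
    unfolding height_def
  proof (rule Weierstrass_m_test)
    show "summable (\<lambda>n. (1 / 2) ^ n :: real)" by (rule summable_geometric) simp
    show "norm ((1 / 2) ^ n * core_mass g (e z n)) \<le> (1 / 2) ^ n" if "z \<in> X" for n z
      using core_mass_bounds[OF assms(1)[OF that], of g n] by (auto simp: abs_mult intro: mult_left_le)
  qed
  moreover have "continuous_on X (\<lambda>z. core_mass g (e z i))" for i
    by (rule continuous_on_compose2[OF continuous_core_mass assms(2)]) (use assms(1) in auto)
  then have "\<forall>\<^sub>F n in sequentially. continuous_on X (\<lambda>z. \<Sum>i<n. (1 / 2) ^ i * core_mass g (e z i))"
    by (intro always_eventually allI continuous_intros)
  ultimately show ?thesis by (intro uniform_limit_theorem) auto
qed

lemma compact_unit_cube: "compact {x :: nat \<Rightarrow> real. \<forall>i. x i \<in> {0..1}}"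
proof -
  have "{x :: nat \<Rightarrow> real. \<forall>i. x i \<in> {0..1}} = (\<Pi>\<^sub>E i\<in>UNIV. {0..1})" by (auto simp: PiE_iff)
  moreover have "compactin (product_topology (\<lambda>i. euclidean) UNIV) (\<Pi>\<^sub>E i\<in>(UNIV :: nat set). {0..1::real})"
    by (simp add: compactin_PiE)
  ultimately show ?thesis by (simp add: euclidean_product_topology)
qed

lemma compact_inverse_limit:
  assumes "continuous_on {0..1} f"
  shows "compact (inverse_limit f)"
proof -
  let ?Q = "{x :: nat \<Rightarrow> real. \<forall>i. x i \<in> {0..1}}"
  have cl: "closed ?Q" using compact_unit_cube by (rule compact_imp_closed)
  have "closed {x \<in> ?Q. f (x (Suc i)) - x i = 0}" for i
    by (rule continuous_closed_preimage_constant[OF _ cl])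
      (auto intro!: continuous_intros continuous_on_compose2[OF assms] continuous_on_coordinate)
  then have "closed (\<Inter>i. {x \<in> ?Q. f (x (Suc i)) - x i = 0})" by blast
  moreover have "inverse_limit f = ?Q \<inter> (\<Inter>i. {x \<in> ?Q. f (x (Suc i)) - x i = 0})"
    by (auto simp: inverse_limit_def)
  ultimately show ?thesis using compact_unit_cube by (simp add: compact_Int_closed)
qed

lemma extend_coordinate:
  assumes f: "interval_map f" and t: "t \<in> {0..1}"
  shows "\<exists>z\<in>inverse_limit f. z k = t"
proof -
  have img: "f ` {0..1} = {0..1}" using f by (simp add: interval_map_def)
  \<comment> \<open>Below index \<open>k\<close> the coordinates are forced; above it a fixed choice \<open>s\<close> of preimages is iterated.\<close>
  define s where "s = inv_into {0..1} f"
  have s: "s y \<in> {0..1} \<and> f (s y) = y" if "y \<in> {0..1}" for y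
    using inv_into_into[of y f "{0..1}"] f_inv_into_f[of y f "{0..1}"] that
    unfolding img s_def by blast
  have fmem: "f y \<in> {0..1}" if "y \<in> {0..1}" for y using img that by blast
  define z where "z i = (if i \<le> k then (f ^^ (k - i)) t else (s ^^ (i - k)) t)" for i
  have sm: "(s ^^ i) t \<in> {0..1}" for i by (induction i) (use s t in auto)
  have fm: "(f ^^ i) t \<in> {0..1}" for i by (induction i) (use fmem t in auto)
  have "f (z (Suc i)) = z i" for i
  proof (cases "i < k")
    case True
    then have "k - i = Suc (k - Suc i)" by simp
    then show ?thesis using True by (simp add: z_def)
  next
    case False
    then have "Suc i - k = Suc (i - k)" by simp
    then show ?thesis using False s[OF sm[of "i - k"]] by (auto simp: z_def)
  qed
  then have "z \<in> inverse_limit f" using sm fm by (auto simp: inverse_limit_def z_def)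
  then show ?thesis by (intro bexI[of _ z]) (auto simp: z_def)
qed

lemma inverse_limit_agree:
  assumes "x \<in> inverse_limit f" "y \<in> inverse_limit f" "x k = y k" "i \<le> k"
  shows "x i = y i"
  using assms(4,3)
proof (induction k)
  case (Suc k)
  have "f (x (Suc k)) = x k" "f (y (Suc k)) = y k"
    using assms(1,2) by (simp_all add: inverse_limit_def)
  then have "x k = y k" using Suc.prems(2) by simp
  then show ?case using Suc.IH Suc.prems by (cases "i = Suc k") simp_all
qed simp

text \<open>Each coordinate maps a separation \<open>A\<close>, \<open>B\<close> onto a covering of the interval by two closed
sets, which must meet. This gives points of \<open>A\<close> and of \<open>B\<close> that agree up to coordinate \<open>k\<close>, for
every \<open>k\<close>, and compactness turns them into a common point.\<close>

lemma connected_inverse_limit: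
  assumes f: "interval_map f"
  shows "connected (inverse_limit f)"
proof (rule ccontr)
  let ?X = "inverse_limit f"
  have comp: "compact ?X" using f compact_inverse_limit by (auto simp: interval_map_def)
  assume "\<not> connected ?X"
  then obtain A B where AB: "closed A" "closed B" "A \<noteq> {}" "B \<noteq> {}" "A \<union> B = ?X" "A \<inter> B = {}"
    using connected_closed_set[OF compact_imp_closed[OF comp]] by blast
  have cAB: "compact A" "compact B"
  proof -
    have "A = ?X \<inter> A" "B = ?X \<inter> B" using AB(5) by blast+
    then show "compact A" "compact B"
      using compact_Int_closed[OF comp AB(1)] compact_Int_closed[OF comp AB(2)] by simp_all
  qed
  have "\<exists>a b. a \<in> A \<and> b \<in> B \<and> a k = b k" for k
  proof -
    let ?\<pi> = "\<lambda>x :: nat \<Rightarrow> real. x k"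
    have "compact (?\<pi> ` A)" "compact (?\<pi> ` B)"
      using cAB by (auto intro!: compact_continuous_image continuous_on_coordinate)
    then have "closed (?\<pi> ` A)" "closed (?\<pi> ` B)" by (auto intro: compact_imp_closed)
    moreover have "?\<pi> ` A \<union> ?\<pi> ` B = {0..1}"
    proof -
      have "?\<pi> ` ?X = {0..1}"
      proof
        show "?\<pi> ` ?X \<subseteq> {0..1}" by (auto simp: inverse_limit_def)
        show "{0..1} \<subseteq> ?\<pi> ` ?X" using extend_coordinate[OF f, of _ k] by blast
      qed
      then show ?thesis using AB(5) by (simp add: image_Un[symmetric])
    qed
    moreover have "connected {0..1::real}" by simp
    ultimately have "?\<pi> ` A \<inter> ?\<pi> ` B \<noteq> {}"
      using AB(3,4) connected_closed_set[of "{0..1::real}"] by auto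
    then show ?thesis by (auto simp: image_iff)
  qed
  then obtain a b where ab: "\<And>k. a k \<in> A" "\<And>k. b k \<in> B" "\<And>k. a k k = b k k" by metis
  obtain l r where l: "l \<in> A" "strict_mono r" "(a \<circ> r) \<longlonglongrightarrow> l"
    by (rule seq_compactE[of A a]) (use cAB(1) ab(1) compact_eq_seq_compact_metric in auto)
  obtain m s where m: "m \<in> B" "strict_mono s" "((b \<circ> r) \<circ> s) \<longlonglongrightarrow> m"
    by (rule seq_compactE[of B "b \<circ> r"]) (use cAB(2) ab(2) compact_eq_seq_compact_metric in auto)
  have "l i = m i" for i
  proof -
    have coord: "(\<lambda>n. u n i) \<longlonglongrightarrow> w i" if "u \<longlonglongrightarrow> w" for u :: "nat \<Rightarrow> nat \<Rightarrow> real" and w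
      using continuous_on_tendsto_compose[OF continuous_on_coordinate[of UNIV i] that] by auto
    have "((a \<circ> r) \<circ> s) \<longlonglongrightarrow> l" using l(3) m(2) by (rule LIMSEQ_subseq_LIMSEQ)
    then have "(\<lambda>n. a (r (s n)) i) \<longlonglongrightarrow> l i" using coord[of "(a \<circ> r) \<circ> s" l] by simp
    moreover have "(\<lambda>n. b (r (s n)) i) \<longlonglongrightarrow> m i" using coord[OF m(3)] by simp
    moreover have "a (r (s n)) i = b (r (s n)) i" if "n \<ge> i" for n
    proof (rule inverse_limit_agree[where k = "r (s n)"])
      show "i \<le> r (s n)" using that seq_suble[OF l(2), of "s n"] seq_suble[OF m(2), of n] by simp
    qed (use ab AB(5) in auto)
    then have "\<forall>\<^sub>F n in sequentially. a (r (s n)) i = b (r (s n)) i"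
      by (auto simp: eventually_sequentially)
    ultimately show ?thesis
      using tendsto_cong[of "\<lambda>n. a (r (s n)) i" "\<lambda>n. b (r (s n)) i" sequentially "l i"] LIMSEQ_unique
      by blast
  qed
  then have "l = m" by (rule ext)
  then show False using l(1) m(1) AB(6) by auto
qed

lemma (in attracting_map) arc_inverse_limit:
  assumes f: "interval_map f" and g: "g = f \<circ> f"
  shows "arc_space (inverse_limit f)"
proof -
  let ?X = "inverse_limit f" and ?e = "\<lambda>(z :: nat \<Rightarrow> real) n. z (2 * n)"
  let ?h = "\<lambda>z. height g (?e z)"
  have e: "?e z n \<in> {0..1}" "g (?e z (Suc n)) = ?e z n" if "z \<in> ?X" for z n
    using that by (auto simp: inverse_limit_def g)
  have ch: "continuous_on ?X ?h"
    by (rule continuous_height) (use e(1) continuous_on_coordinate in auto)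
  have inj: "inj_on ?h ?X"
  proof (rule inj_onI)
    fix z w assume zw: "z \<in> ?X" "w \<in> ?X" "?h z = ?h w"
    have "?e z = ?e w"
      by (rule height_inj) (use e[OF zw(1)] e[OF zw(2)] zw(3) in simp_all)
    then have "z (2 * i) = w (2 * i)" for i by (rule fun_cong)
    then have "z i = w i" for i using inverse_limit_agree[OF zw(1,2), of "2 * i" i] by simp
    then show "z = w" by auto
  qed
  have comp: "compact ?X" using f compact_inverse_limit by (auto simp: interval_map_def)
  have "compact (?h ` ?X)" "connected (?h ` ?X)"
    using comp ch connected_inverse_limit[OF f]
    by (auto intro: compact_continuous_image connected_continuous_image)
  then obtain a b where ab: "?h ` ?X = {a..b}" using connected_compact_interval_1[of "?h ` ?X"] by auto
  obtain z w where zw: "z \<in> ?X" "w \<in> ?X" "z 0 = 0" "w 0 = 1"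
    using extend_coordinate[OF f, of 0 0] extend_coordinate[OF f, of 1 0] by auto
  then have "?h z \<noteq> ?h w" using inj by (auto simp: inj_on_def)
  moreover have "?h z \<in> {a..b}" "?h w \<in> {a..b}" using ab zw by blast+
  ultimately have "a < b" by auto
  have "?X homeomorphic {a..b}" using homeomorphic_compact[OF comp ch ab inj] .
  also have "{a..b} homeomorphic {0..1::real}"
    using \<open>a < b\<close> by (intro homeomorphic_closed_intervals_real) auto
  finally show ?thesis by (simp add: arc_space_def)
qed

section \<open>Critical points and local injectivity\<close>

text \<open>Equal values at both ends force an interior extremum.\<close>

lemma critical_between:
  assumes cont: "continuous_on {0..1} f" and uv: "u \<in> {0..1}" "v \<in> {0..1}" "u < v" "f u = f v"
  obtains c where "c \<in> {u<..<v}" "critical_point f c"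
proof -
  have cuv: "continuous_on {u..v} f" using cont by (rule continuous_on_subset) (use uv in auto)
  obtain M where M: "M \<in> {u..v}" "\<And>y. y \<in> {u..v} \<Longrightarrow> f y \<le> f M"
    using continuous_attains_sup[OF _ _ cuv] uv(3) by auto
  obtain m where m: "m \<in> {u..v}" "\<And>y. y \<in> {u..v} \<Longrightarrow> f m \<le> f y"
    using continuous_attains_inf[OF _ _ cuv] uv(3) by auto
  obtain c where c: "c \<in> {u<..<v}" "(\<forall>y\<in>{u..v}. f y \<le> f c) \<or> (\<forall>y\<in>{u..v}. f c \<le> f y)"
  proof -
    consider "M \<in> {u<..<v}" | "m \<in> {u<..<v}" | "M \<notin> {u<..<v}" "m \<notin> {u<..<v}" by blast
    then show ?thesis
    proof cases
      case 1
      then show ?thesis using that[of M] M(2) by simp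
    next
      case 2
      then show ?thesis using that[of m] m(2) by simp
    next
      case 3
      then have "M = u \<or> M = v" "m = u \<or> m = v" using M(1) m(1) by auto
      then have "f M = f u" "f m = f u" using uv(4) by auto
      moreover have mid: "(u + v) / 2 \<in> {u<..<v}" using uv(3) by simp
      ultimately have "f y \<le> f ((u + v) / 2)" if "y \<in> {u..v}" for y
        using M(2)[OF that] m(2)[of "(u + v) / 2"] by simp
      then show ?thesis using that[OF mid] by blast
    qed
  qed
  have "\<not> inj_on f J" if J: "openin (top_of_set {0..1}) J" "c \<in> J" for J
  proof
    assume inj: "inj_on f J"
    have "\<forall>x\<in>J. \<exists>d>0. ball x d \<inter> {0..1} \<subseteq> J"
      using J(1) unfolding openin_contains_ball by blast
    from bspec[OF this J(2)] obtain d where d: "d > 0" "ball c d \<inter> {0..1} \<subseteq> J" by blast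
    define e where "e = min (d / 2) (min (c - u) (v - c))"
    have e: "e > 0" "e < d" "u \<le> c - e" "c + e \<le> v" using c(1) d(1) by (auto simp: e_def min_def)
    have "{c-e..c+e} \<subseteq> J"
    proof
      fix x assume "x \<in> {c-e..c+e}"
      then have "x \<in> ball c d \<inter> {0..1}" using e uv by (auto simp: dist_real_def)
      then show "x \<in> J" using d by blast
    qed
    then have "inj_on f {c-e..c+e}" using inj inj_on_subset by blast
    moreover have "continuous_on {c-e..c+e} f" using cuv by (rule continuous_on_subset) (use e in auto)
    ultimately have "(f (c-e) < f c \<and> f c < f (c+e)) \<or> (f (c+e) < f c \<and> f c < f (c-e))"
      using e by (intro continuous_inj_imp_mono) auto
    moreover have "c - e \<in> {u..v}" "c + e \<in> {u..v}" using e c(1) by auto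
    ultimately show False using c(2) by (elim disjE) (force dest: bspec)+
  qed
  then have "critical_point f c" using c(1) uv by (auto simp: critical_point_def)
  then show thesis using that c(1) by blast
qed

lemma locally_injective_one_sided:
  assumes f: "interval_map f" "piecewise_monotone f"
  obtains d where "d > 0" "inj_on f ({q..q+d} \<inter> {0..1})" "inj_on f ({q-d..q} \<inter> {0..1})"
proof -
  obtain d where d: "d > 0" "\<And>c. critical_point f c \<Longrightarrow> c \<noteq> q \<Longrightarrow> d \<le> \<bar>q - c\<bar>"
    using finite_set_avoid[of "{c. critical_point f c}" q] f(2)
    by (auto simp: piecewise_monotone_def dist_real_def)
  have "inj_on f S" if S: "S \<subseteq> {0..1}" "\<And>x y c. x \<in> S \<Longrightarrow> y \<in> S \<Longrightarrow> c \<in> {x<..<y} \<Longrightarrow> c \<noteq> q \<and> \<bar>q - c\<bar> < d" for S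
  proof (rule linorder_inj_onI')
    fix x y assume xy: "x \<in> S" "y \<in> S" "x < y"
    show "f x \<noteq> f y"
    proof
      assume "f x = f y"
      moreover have "continuous_on {0..1} f" "x \<in> {0..1}" "y \<in> {0..1}"
        using f(1) xy S(1) by (auto simp: interval_map_def)
      ultimately obtain c where "c \<in> {x<..<y}" "critical_point f c"
        using critical_between[of f x y] xy(3) by blast
      then show False using d(2)[of c] S(2)[OF xy(1,2), of c] by auto
    qed
  qed
  from this[of "{q..q+d} \<inter> {0..1}"] this[of "{q-d..q} \<inter> {0..1}"] show thesis
    by (intro that[OF d(1)]) auto
qed

text \<open>A one-sided neighbourhood of \<open>p\<close>, if small, is mapped by \<open>f\<close> monotonically into a one-sided
neighbourhood of \<open>f p\<close>, on which \<open>f\<close> is injective again.\<close>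

lemma inj_square_one_sided:
  assumes f: "interval_map f" "piecewise_monotone f" and p: "p \<in> {0..1}"
  obtains e where "e > 0" "inj_on (f \<circ> f) ({p..p+e} \<inter> {0..1})" "inj_on (f \<circ> f) ({p-e..p} \<inter> {0..1})"
proof -
  obtain d where d: "d > 0" "inj_on f ({p..p+d} \<inter> {0..1})" "inj_on f ({p-d..p} \<inter> {0..1})"
    using locally_injective_one_sided[OF f] by blast
  obtain d' where d': "d' > 0" "inj_on f ({f p..f p+d'} \<inter> {0..1})" "inj_on f ({f p-d'..f p} \<inter> {0..1})"
    using locally_injective_one_sided[OF f] by blast
  have cont: "continuous_on {0..1} f" using f by (simp add: interval_map_def)
  obtain r where r: "r > 0" "\<And>x. x \<in> {0..1} \<Longrightarrow> \<bar>x - p\<bar> < r \<Longrightarrow> \<bar>f x - f p\<bar> < d'"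
    using cont p d'(1) unfolding continuous_on_iff dist_real_def by blast
  define e where "e = min d (r / 2)"
  have e: "e > 0" "e \<le> d" "e < r" using d r by (auto simp: e_def)
  have comp: "inj_on (f \<circ> f) S"
    if S: "is_interval S" "S \<subseteq> {0..1}" "\<And>x. x \<in> S \<Longrightarrow> \<bar>x - p\<bar> < r" "inj_on f S" "p \<in> S"
      and side: "(\<forall>x\<in>S. p \<le> x) \<or> (\<forall>x\<in>S. x \<le> p)" for S
  proof -
    have "continuous_on S f" using cont S(2) by (rule continuous_on_subset)
    then have "strict_mono_on S f \<or> strict_antimono_on S f"
      using injective_eq_monotone_map[OF S(1)] S(4) by blast
    then have "(\<forall>x\<in>S. f p \<le> f x) \<or> (\<forall>x\<in>S. f x \<le> f p)"
      using side unfolding monotone_on_def le_less by (elim disjE) (use S(5) in blast)+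
    moreover have "f x \<in> {0..1} \<and> \<bar>f x - f p\<bar> < d'" if "x \<in> S" for x
      using r(2)[of x] S(2) S(3)[OF that] that f(1) by (force simp: interval_map_def)
    ultimately have "f ` S \<subseteq> {f p..f p+d'} \<inter> {0..1} \<or> f ` S \<subseteq> {f p-d'..f p} \<inter> {0..1}"
      by fastforce
    then have "inj_on f (f ` S)" using d'(2,3) inj_on_subset by blast
    then show ?thesis using S(4) by (intro comp_inj_on)
  qed
  have "inj_on (f \<circ> f) ({p..p+e} \<inter> {0..1})"
    by (rule comp) (use e p d in \<open>auto intro: is_interval_Int is_interval_cc inj_on_subset[OF d(2)]\<close>)
  moreover have "inj_on (f \<circ> f) ({p-e..p} \<inter> {0..1})"
    by (rule comp) (use e p d in \<open>auto intro: is_interval_Int is_interval_cc inj_on_subset[OF d(3)]\<close>)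
  ultimately show thesis using that e by blast
qed

lemma interval_map_square:
  assumes "interval_map f"
  shows "interval_map (f \<circ> f)"
  unfolding interval_map_def
proof
  have c: "continuous_on {0..1} f" and o: "f ` {0..1} = {0..1}"
    using assms by (auto simp: interval_map_def)
  show "continuous_on {0..1} (f \<circ> f)" by (rule continuous_on_compose) (use c o in simp_all)
  show "(f \<circ> f) ` {0..1} = {0..1}" by (simp only: image_comp[symmetric] o)
qed

lemma attracting_square:
  assumes f: "interval_map f" "piecewise_monotone f"
    and conv: "\<forall>x\<in>{0..1}. \<exists>y\<in>fix_set (f \<circ> f). attracted_to (f \<circ> f) x y"
    and comps: "\<forall>C\<in>components ({0..1} - fix_set (f \<circ> f)).
       \<exists>y\<in>fix_set (f \<circ> f). \<forall>x\<in>C. attracted_to (f \<circ> f) x y"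
  shows "attracting_map (f \<circ> f)"
proof
  show "interval_map (f \<circ> f)" by (rule interval_map_square[OF f(1)])
  show "\<exists>p\<in>fix_set (f \<circ> f). attracted_to (f \<circ> f) x p" if "x \<in> {0..1}" for x using conv that by blast
  show "attracted_to (f \<circ> f) y p"
    if "x \<in> {0..1}" "y \<in> {0..1}" "closed_segment x y \<inter> fix_set (f \<circ> f) = {}" "attracted_to (f \<circ> f) x p"
    for x y p
  proof -
    have "closed_segment x y \<subseteq> {0..1}" using that(1,2) by (auto simp: closed_segment_eq_real_ivl)
    then have "closed_segment x y \<subseteq> {0..1} - fix_set (f \<circ> f)" using that(3) by blast
    then obtain C where "C \<in> components ({0..1} - fix_set (f \<circ> f))" "closed_segment x y \<subseteq> C"
      using exists_component_superset[of "closed_segment x y" "{0..1} - fix_set (f \<circ> f)"] by force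
    then show ?thesis using comps attracted_unique that(4) by (metis ends_in_segment(1,2) subsetD)
  qed
  show "\<exists>e>0. p + e \<le> 1 \<and> inj_on (f \<circ> f) {p..p+e}" if "p \<in> fix_set (f \<circ> f)" "p < 1" for p
  proof -
    have "p \<in> {0..1}" using that by (simp add: fix_set_def)
    then obtain e where e: "e > 0" "inj_on (f \<circ> f) ({p..p+e} \<inter> {0..1})"
      using inj_square_one_sided[OF f] by blast
    have "inj_on (f \<circ> f) {p..p + min e (1 - p)}"
      by (rule inj_on_subset[OF e(2)]) (use that in \<open>auto simp: fix_set_def\<close>)
    then show ?thesis using e(1) that by (intro exI[of _ "min e (1 - p)"]) auto
  qed
  show "\<exists>e>0. 0 \<le> p - e \<and> inj_on (f \<circ> f) {p-e..p}" if "p \<in> fix_set (f \<circ> f)" "0 < p" for p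
  proof -
    have "p \<in> {0..1}" using that by (simp add: fix_set_def)
    then obtain e where e: "e > 0" "inj_on (f \<circ> f) ({p-e..p} \<inter> {0..1})"
      using inj_square_one_sided[OF f] by blast
    have "inj_on (f \<circ> f) {p - min e p..p}"
      by (rule inj_on_subset[OF e(2)]) (use that in \<open>auto simp: fix_set_def\<close>)
    then show ?thesis using e(1) that by (intro exI[of _ "min e p"]) auto
  qed
qed

section \<open>Dynamics of a map whose inverse limit is an arc\<close>

text \<open>The situation produced by an arc: \<open>P\<close> is coordinate \<open>0\<close> as a function of the parameter of the
arc, and \<open>H\<close> is the square of the shift. Passing to the square removes a possible
reversal of the arc. \<open>lift\<close> expresses that every backward orbit of \<open>g\<close> comes from a
point of the arc.\<close>

locale monotone_extension = unit_interval_map g for g +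
  fixes H P :: "real \<Rightarrow> real"
  assumes H_mono: "strict_mono_on {0..1} H" and H_mem: "t \<in> {0..1} \<Longrightarrow> H t \<in> {0..1}"
    and P_cont: "continuous_on {0..1} P" and P_onto: "P ` {0..1} = {0..1}"
    and semiconj: "t \<in> {0..1} \<Longrightarrow> P (H t) = g (P t)"
    and lift: "\<lbrakk>\<And>n. x n \<in> {0..1}; \<And>n. g (x (Suc n)) = x n\<rbrakk>
      \<Longrightarrow> \<exists>t. \<forall>n. t n \<in> {0..1} \<and> H (t (Suc n)) = t n \<and> P (t n) = x n"
begin

lemma H_iter_mem: "t \<in> {0..1} \<Longrightarrow> (H ^^ n) t \<in> {0..1}"
  by (induction n) (use H_mem in auto)

lemma H_iter_le: "\<lbrakk>s \<in> {0..1}; t \<in> {0..1}; s \<le> t\<rbrakk> \<Longrightarrow> (H ^^ n) s \<le> (H ^^ n) t"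
proof (induction n)
  case (Suc n)
  then show ?case
    using strict_mono_on_leD[OF H_mono, of "(H ^^ n) s" "(H ^^ n) t"] H_iter_mem by simp
qed simp

lemma P_iter: "t \<in> {0..1} \<Longrightarrow> P ((H ^^ n) t) = (g ^^ n) (P t)"
  by (induction n) (use semiconj H_iter_mem in auto)

lemma P_mem: "t \<in> {0..1} \<Longrightarrow> P t \<in> {0..1}"
  using P_onto by blast

lemma P_tendsto:
  assumes "t \<longlonglongrightarrow> u" "\<And>n. t n \<in> {0..1}"
  shows "u \<in> {0..1}" "(\<lambda>n. P (t n)) \<longlonglongrightarrow> P u"
proof -
  show "u \<in> {0..1}" using closed_sequentially[of "{0..1}" t u] assms by auto
  then show "(\<lambda>n. P (t n)) \<longlonglongrightarrow> P u"
    by (intro continuous_on_tendsto_compose[OF P_cont assms(1)]) (use assms(2) in auto)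
qed

lemma monotone_converges:
  fixes t :: "nat \<Rightarrow> real"
  assumes "\<And>n. t n \<in> {0..1}" "monoseq t"
  obtains u where "t \<longlonglongrightarrow> u"
proof -
  have "Bseq t" by (rule BseqI'[of _ 1]) (use assms(1) in auto)
  then show thesis using that Bseq_monoseq_convergent[OF _ assms(2)] by (auto simp: convergent_def)
qed

lemma orbit_converges:
  assumes t: "t \<in> {0..1}"
  obtains v where "(\<lambda>n. (H ^^ n) t) \<longlonglongrightarrow> v"
proof -
  have "monoseq (\<lambda>n. (H ^^ n) t)"
  proof (cases "t \<le> H t")
    case True
    have "(H ^^ n) t \<le> (H ^^ Suc n) t" for n
      using H_iter_le[OF t H_mem[OF t] True, of n] by (simp add: funpow_swap1)
    then show ?thesis by (auto simp: monoseq_Suc)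
  next
    case False
    then have "(H ^^ Suc n) t \<le> (H ^^ n) t" for n
      using H_iter_le[OF H_mem[OF t] t, of n] by (simp add: funpow_swap1)
    then show ?thesis by (auto simp: monoseq_Suc)
  qed
  then show thesis using monotone_converges[of "\<lambda>n. (H ^^ n) t"] H_iter_mem[OF t] that by blast
qed

lemma attracted_projection:
  assumes t: "t \<in> {0..1}" and v: "(\<lambda>n. (H ^^ n) t) \<longlonglongrightarrow> v"
  shows "attracted_to g (P t) (P v)" "P v \<in> fix_set g"
proof -
  have lim: "(\<lambda>n. (g ^^ n) (P t)) \<longlonglongrightarrow> P v" and v01: "v \<in> {0..1}"
    using P_tendsto[OF v H_iter_mem[OF t]] by (simp_all add: P_iter[OF t])
  then show "attracted_to g (P t) (P v)" by (simp add: attracted_to_def)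
  show "P v \<in> fix_set g"
  proof (rule fixed_if_image_limit[OF _ lim])
    show "(g ^^ n) (P t) \<in> {0..1}" for n
      using P_mem[OF H_iter_mem[OF t, of n]] by (simp add: P_iter[OF t])
    show "(\<lambda>n. g ((g ^^ n) (P t))) \<longlonglongrightarrow> P v" using LIMSEQ_Suc[OF lim] by simp
  qed
qed

lemma every_point_attracted:
  assumes "x \<in> {0..1}"
  shows "\<exists>p\<in>fix_set g. attracted_to g x p"
proof -
  obtain t where "t \<in> {0..1}" "P t = x" using assms P_onto by (metis imageE)
  then show ?thesis using orbit_converges attracted_projection by metis
qed

text \<open>The lifted backward orbit is monotone, with a limit \<open>u\<close>. A point \<open>y\<close> between
\<open>P u\<close> and \<open>x 0\<close> is the image of some parameter \<open>s\<close> between \<open>u\<close> and \<open>t 0\<close>. As \<open>y\<close> is not fixed,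
\<open>s\<close> differs from \<open>u\<close>, hence lies between \<open>t n\<close> and \<open>t 0\<close> for some \<open>n\<close>; these two lie on one
orbit of the increasing map \<open>H\<close> and squeeze the orbit of \<open>s\<close>.\<close>

lemma backward_orbit_limit:
  assumes x: "\<And>n. x n \<in> {0..1}" "\<And>n. g (x (Suc n)) = x n"
  obtains p where "p \<in> fix_set g" "x \<longlonglongrightarrow> p"
    "\<And>y q. \<lbrakk>y \<in> closed_segment p (x 0); y \<notin> fix_set g; attracted_to g (x 0) q\<rbrakk> \<Longrightarrow> attracted_to g y q"
proof -
  from lift[of x, OF x] obtain t where
    "\<forall>n. t n \<in> {0..1} \<and> H (t (Suc n)) = t n \<and> P (t n) = x n" ..
  then have t: "t n \<in> {0..1}" "H (t (Suc n)) = t n" "P (t n) = x n" for n by blast+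
  have step: "t n \<le> t (Suc n) \<longleftrightarrow> t (Suc n) \<le> t (Suc (Suc n))" for n
    using strict_mono_on_less_eq[OF H_mono t(1)[of "Suc n"] t(1)[of "Suc (Suc n)"]] t(2) by simp
  have dir: "t n \<le> t (Suc n) \<longleftrightarrow> t 0 \<le> t (Suc 0)" for n
  proof (induction n)
    case (Suc n)
    then show ?case using step[of n] by blast
  qed simp
  have "monoseq t"
    unfolding monoseq_Suc
  proof (cases "t 0 \<le> t (Suc 0)")
    case True
    then show "(\<forall>n. t n \<le> t (Suc n)) \<or> (\<forall>n. t (Suc n) \<le> t n)" using dir by blast
  next
    case False
    then have "\<not> t n \<le> t (Suc n)" for n using dir by blast
    then show "(\<forall>n. t n \<le> t (Suc n)) \<or> (\<forall>n. t (Suc n) \<le> t n)" by (meson le_cases)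
  qed
  then obtain u where u: "t \<longlonglongrightarrow> u" using monotone_converges[of t] t(1) by blast
  define p where "p = P u"
  have u01: "u \<in> {0..1}" and lim: "x \<longlonglongrightarrow> p" using P_tendsto[OF u t(1)] by (simp_all add: t(3) p_def)
  have p: "p \<in> fix_set g"
    by (rule limit_is_fixed[of x, OF x lim])
  have "attracted_to g y q"
    if y: "y \<in> closed_segment p (x 0)" "y \<notin> fix_set g" "attracted_to g (x 0) q" for y q
  proof -
    have sub: "closed_segment u (t 0) \<subseteq> {0..1}"
      using u01 t(1)[of 0] by (auto simp: closed_segment_eq_real_ivl)
    have "connected (P ` closed_segment u (t 0))"
      by (intro connected_continuous_image continuous_on_subset[OF P_cont sub]) simp
    then have "convex (P ` closed_segment u (t 0))"
      using is_interval_connected_1 is_interval_convex_1 by blast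
    then have "closed_segment p (x 0) \<subseteq> P ` closed_segment u (t 0)"
      by (intro closed_segment_subset) (auto simp: p_def t(3)[symmetric])
    then obtain s where s: "s \<in> closed_segment u (t 0)" "P s = y" using y(1) by auto
    have s01: "s \<in> {0..1}" using s sub by blast
    have "s \<noteq> u" using s y(2) p by (auto simp: p_def)
    have "\<exists>n. s \<in> closed_segment (t n) (t 0)"
    proof (cases "u < s")
      case True
      then obtain n where "t n < s"
        using order_tendstoD(2)[OF u True] by (auto simp: eventually_sequentially)
      moreover have "s \<le> t 0" using s True by (auto simp: closed_segment_eq_real_ivl split: if_splits)
      ultimately have "s \<in> closed_segment (t n) (t 0)" by (simp add: closed_segment_eq_real_ivl)
      then show ?thesis ..
    next
      case False
      then have "s < u" using \<open>s \<noteq> u\<close> by simp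
      then obtain n where "s < t n"
        using order_tendstoD(1)[OF u \<open>s < u\<close>] by (auto simp: eventually_sequentially)
      moreover have "t 0 \<le> s" using s \<open>s < u\<close> by (auto simp: closed_segment_eq_real_ivl split: if_splits)
      ultimately have "s \<in> closed_segment (t n) (t 0)" by (auto simp: closed_segment_eq_real_ivl)
      then show ?thesis ..
    qed
    then obtain n where n: "s \<in> closed_segment (t n) (t 0)" ..
    obtain v where v: "(\<lambda>m. (H ^^ m) (t 0)) \<longlonglongrightarrow> v" using orbit_converges t(1) by blast
    have "(H ^^ n) (t (0 + n)) = t 0" by (rule backward_iterate[of H t n 0]) (rule t(2))
    then have "(H ^^ (m + n)) (t n) = (H ^^ m) (t 0)" for m by (simp add: funpow_add)
    then have vn: "(\<lambda>m. (H ^^ m) (t n)) \<longlonglongrightarrow> v"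
      using LIMSEQ_offset[of "\<lambda>m. (H ^^ m) (t n)" n v] v by simp
    have between: "\<bar>(H ^^ m) s - v\<bar> \<le> \<bar>(H ^^ m) (t n) - v\<bar> + \<bar>(H ^^ m) (t 0) - v\<bar>" for m
    proof (cases "t n \<le> t 0")
      case True
      then have "(H ^^ m) (t n) \<le> (H ^^ m) s" "(H ^^ m) s \<le> (H ^^ m) (t 0)"
        using n s01 t(1) by (auto intro!: H_iter_le simp: closed_segment_eq_real_ivl)
      then show ?thesis by linarith
    next
      case False
      then have "(H ^^ m) (t 0) \<le> (H ^^ m) s" "(H ^^ m) s \<le> (H ^^ m) (t n)"
        using n s01 t(1) by (auto intro!: H_iter_le simp: closed_segment_eq_real_ivl)
      then show ?thesis by linarith
    qed
    have "(\<lambda>m. \<bar>(H ^^ m) (t n) - v\<bar> + \<bar>(H ^^ m) (t 0) - v\<bar>) \<longlonglongrightarrow> \<bar>v - v\<bar> + \<bar>v - v\<bar>"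
      by (intro tendsto_intros vn v)
    then have null: "(\<lambda>m. \<bar>(H ^^ m) (t n) - v\<bar> + \<bar>(H ^^ m) (t 0) - v\<bar>) \<longlonglongrightarrow> 0"
      by (simp only: diff_self abs_zero add_0)
    have "(\<lambda>m. (H ^^ m) s - v) \<longlonglongrightarrow> 0"
      by (rule Lim_null_comparison[OF always_eventually null]) (simp only: real_norm_def between simp_thms)
    then have "(\<lambda>m. (H ^^ m) s) \<longlonglongrightarrow> v" by (simp only: LIM_zero_iff)
    from attracted_projection(1)[OF s01 this] have "attracted_to g y (P v)" by (simp only: s(2))
    moreover have "attracted_to g (x 0) (P v)"
      using attracted_projection(1)[OF t(1) v] by (simp only: t(3))
    ultimately show ?thesis using attracted_unique y(3) by blast
  qed
  then show thesis using that p lim by blast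
qed

text \<open>By \<open>backward_orbit_limit\<close> it suffices that one of the two points has a backward orbit whose limit
lies beyond the other. If points move up and there is a fixed point \<open>a\<close> below, then
\<open>{a..y}\<close> is covered by its image, so \<open>y\<close> has a backward orbit inside it, whose limit can only
be below \<open>x\<close>. If there is no fixed point below, then every backward orbit of \<open>x\<close> has its limit above \<open>y\<close>. The other two cases are mirror images.\<close>

lemma one_limit_determines_other:
  assumes x: "x \<in> {0..1}" and y: "y \<in> {0..1}" and xy: "x < y" "{x..y} \<inter> fix_set g = {}"
  shows "(\<forall>q. attracted_to g x q \<longrightarrow> attracted_to g y q) \<or> (\<forall>q. attracted_to g y q \<longrightarrow> attracted_to g x q)"
proof -
  have "x \<in> {x..y}" "y \<in> {x..y}" using xy(1) by simp_all
  then have nofix: "x \<notin> fix_set g" "y \<notin> fix_set g" using xy(2) by blast+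
  consider "y < g y" "\<exists>a\<in>fix_set g. a \<le> x" | "\<not> (\<exists>a\<in>fix_set g. a \<le> x)"
    | "g y \<le> y" "\<exists>b\<in>fix_set g. y \<le> b" | "\<not> (\<exists>b\<in>fix_set g. y \<le> b)" by linarith
  then show ?thesis
  proof cases
    case 1
    then obtain a where a: "a \<in> fix_set g" "a \<le> x" by blast
    have a01: "a \<in> {0..1}" "g a = a" using a by (auto simp: fix_set_def)
    have "{a..y} \<subseteq> g ` {a..y}"
    proof
      fix z assume "z \<in> {a..y}"
      then show "z \<in> g ` {a..y}"
        using value_between[of a y z] a01 y 1(1) by (auto simp: closed_segment_eq_real_ivl)
    qed
    moreover have "y \<in> {a..y}" using a xy by simp
    ultimately obtain t where t: "t 0 = y" "\<And>n. t n \<in> {a..y}" "\<And>n. g (t (Suc n)) = t n"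
      using backward_orbit_within by blast
    have t01: "t n \<in> {0..1}" for n using t(2)[of n] a01 y by auto
    obtain p where p: "p \<in> fix_set g" "t \<longlonglongrightarrow> p"
      "\<And>w q. \<lbrakk>w \<in> closed_segment p (t 0); w \<notin> fix_set g; attracted_to g (t 0) q\<rbrakk> \<Longrightarrow> attracted_to g w q"
      using backward_orbit_limit[of t, OF t01 t(3)] by blast
    have "p \<le> y" by (rule LIMSEQ_le_const2[OF p(2)]) (use t(2) in auto)
    moreover have "p \<notin> {x..y}" using p(1) xy(2) by blast
    ultimately have "x \<in> closed_segment p y" using xy(1) by (auto simp: closed_segment_eq_real_ivl)
    then show ?thesis using p(3)[of x] nofix(1) t(1) by blast
  next
    case 2
    have "{0..1} \<subseteq> g ` {0..1}" using onto by simp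
    then obtain t where t: "t 0 = x" "\<And>n. t n \<in> {0..1}" "\<And>n. g (t (Suc n)) = t n"
      using backward_orbit_within x by blast
    obtain p where p: "p \<in> fix_set g" "t \<longlonglongrightarrow> p"
      "\<And>w q. \<lbrakk>w \<in> closed_segment p (t 0); w \<notin> fix_set g; attracted_to g (t 0) q\<rbrakk> \<Longrightarrow> attracted_to g w q"
      using backward_orbit_limit[of t, OF t(2,3)] by blast
    have "x < p" using 2 p(1) by force
    moreover have "p \<notin> {x..y}" using p(1) xy(2) by blast
    ultimately have "y \<in> closed_segment p x" using xy(1) by (auto simp: closed_segment_eq_real_ivl)
    then show ?thesis using p(3)[of y] nofix(2) t(1) by blast
  next
    case 3
    then obtain b where b: "b \<in> fix_set g" "y \<le> b" by blast
    have b01: "b \<in> {0..1}" "g b = b" using b by (auto simp: fix_set_def)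
    have "g x \<le> x"
    proof (rule ccontr)
      assume "\<not> g x \<le> x"
      then obtain p where "p \<in> closed_segment x y" "p \<in> fix_set g"
        using fix_between[OF x y] 3(1) by auto
      then show False using xy by (auto simp: closed_segment_eq_real_ivl)
    qed
    have "{x..b} \<subseteq> g ` {x..b}"
    proof
      fix z assume "z \<in> {x..b}"
      then show "z \<in> g ` {x..b}"
        using value_between[of x b z] b01 x \<open>g x \<le> x\<close> by (auto simp: closed_segment_eq_real_ivl)
    qed
    moreover have "x \<in> {x..b}" using b xy by simp
    ultimately obtain t where t: "t 0 = x" "\<And>n. t n \<in> {x..b}" "\<And>n. g (t (Suc n)) = t n"
      using backward_orbit_within by blast
    have t01: "t n \<in> {0..1}" for n using t(2)[of n] b01 x by auto
    obtain p where p: "p \<in> fix_set g" "t \<longlonglongrightarrow> p"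
      "\<And>w q. \<lbrakk>w \<in> closed_segment p (t 0); w \<notin> fix_set g; attracted_to g (t 0) q\<rbrakk> \<Longrightarrow> attracted_to g w q"
      using backward_orbit_limit[of t, OF t01 t(3)] by blast
    have "x \<le> p" by (rule LIMSEQ_le_const[OF p(2)]) (use t(2) in auto)
    moreover have "p \<notin> {x..y}" using p(1) xy(2) by blast
    ultimately have "y \<in> closed_segment p x" using xy(1) by (auto simp: closed_segment_eq_real_ivl)
    then show ?thesis using p(3)[of y] nofix(2) t(1) by blast
  next
    case 4
    have "{0..1} \<subseteq> g ` {0..1}" using onto by simp
    then obtain t where t: "t 0 = y" "\<And>n. t n \<in> {0..1}" "\<And>n. g (t (Suc n)) = t n"
      using backward_orbit_within y by blast
    obtain p where p: "p \<in> fix_set g" "t \<longlonglongrightarrow> p"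
      "\<And>w q. \<lbrakk>w \<in> closed_segment p (t 0); w \<notin> fix_set g; attracted_to g (t 0) q\<rbrakk> \<Longrightarrow> attracted_to g w q"
      using backward_orbit_limit[of t, OF t(2,3)] by blast
    have "p < y" using 4 p(1) by force
    moreover have "p \<notin> {x..y}" using p(1) xy(2) by blast
    ultimately have "x \<in> closed_segment p y" using xy(1) by (auto simp: closed_segment_eq_real_ivl)
    then show ?thesis using p(3)[of x] nofix(1) t(1) by blast
  qed
qed

lemma component_same_limit:
  assumes C: "C \<in> components ({0..1} - fix_set g)"
  shows "\<exists>p\<in>fix_set g. \<forall>x\<in>C. attracted_to g x p"
proof -
  have sub: "C \<subseteq> {0..1} - fix_set g" and conn: "connected C" and "C \<noteq> {}"
    by (rule in_components_subset[OF C], rule in_components_connected[OF C], rule in_components_nonempty[OF C])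
  then obtain x where x: "x \<in> C" by blast
  have "x \<in> {0..1}" using x sub by blast
  then obtain p where p: "p \<in> fix_set g" "attracted_to g x p" using every_point_attracted[of x] by blast
  have ordered: "attracted_to g u r \<longleftrightarrow> attracted_to g v r" if uv: "u \<in> C" "v \<in> C" "u < v" for u v r
  proof -
    have "{u..v} \<subseteq> C" using connected_contains_Icc[OF conn uv(1,2)] .
    then have free: "{u..v} \<inter> fix_set g = {}" and u: "u \<in> {0..1}" and v: "v \<in> {0..1}"
      using sub uv(1,2) by blast+
    obtain p where p: "attracted_to g u p" using every_point_attracted[OF u] by blast
    obtain q where q: "attracted_to g v q" using every_point_attracted[OF v] by blast
    have "p = q" using one_limit_determines_other[OF u v uv(3) free]
    proof
      assume "\<forall>r. attracted_to g u r \<longrightarrow> attracted_to g v r"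
      then have "attracted_to g v p" using p by blast
      then show "p = q" using q by (rule attracted_unique)
    next
      assume "\<forall>r. attracted_to g v r \<longrightarrow> attracted_to g u r"
      then have "attracted_to g u q" using q by blast
      with p show "p = q" by (rule attracted_unique)
    qed
    show ?thesis
    proof
      assume "attracted_to g u r"
      with p have "p = r" by (rule attracted_unique)
      then show "attracted_to g v r" using q \<open>p = q\<close> by (simp only:)
    next
      assume "attracted_to g v r"
      with q have "q = r" by (rule attracted_unique)
      then show "attracted_to g u r" using p \<open>p = q\<close> by (simp only:)
    qed
  qed
  have "attracted_to g y p" if "y \<in> C" for y
  proof (cases x y rule: linorder_cases)
    case less
    show ?thesis using ordered[OF x that less, of p] p(2) by simp
  next
    case equal
    then show ?thesis using p(2) by simp
  next
    case greater
    show ?thesis using ordered[OF that x greater, of p] p(2) by simp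
  qed
  then show ?thesis using p(1) by blast
qed

end

text \<open>The homeomorphism with the interval conjugates the shift \<open>h\<close> of the inverse limit to an
injective continuous map \<open>k\<close> of the interval, which is strictly monotone; \<open>k \<circ> k\<close> is then increasing in either case.\<close>

lemma arc_monotone_extension:
  assumes f: "interval_map f" and arc: "arc_space (inverse_limit f)"
  shows "\<exists>H P. monotone_extension (f \<circ> f) H P"
proof -
  let ?X = "inverse_limit f" and ?I = "{0..1::real}"
  have c: "continuous_on ?I f" and o: "f ` ?I = ?I" using f by (auto simp: interval_map_def)
  obtain \<phi> \<psi> where hom: "homeomorphism ?X ?I \<phi> \<psi>"
    using arc by (auto simp: arc_space_def homeomorphic_def)
  have \<phi>: "\<And>z. z \<in> ?X \<Longrightarrow> \<phi> z \<in> ?I" "\<And>z. z \<in> ?X \<Longrightarrow> \<psi> (\<phi> z) = z" "continuous_on ?X \<phi>"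
    using hom by (auto simp: homeomorphism_def)
  have \<psi>: "\<And>t. t \<in> ?I \<Longrightarrow> \<psi> t \<in> ?X" "\<And>t. t \<in> ?I \<Longrightarrow> \<phi> (\<psi> t) = t" "continuous_on ?I \<psi>"
    using hom by (auto simp: homeomorphism_def)
  define h where "h z = case_nat (f (z 0)) z" for z :: "nat \<Rightarrow> real"
  have hX: "h z \<in> ?X" if "z \<in> ?X" for z
  proof -
    have "f (z 0) \<in> ?I" using that o by (auto simp: inverse_limit_def)
    then show ?thesis using that by (auto simp: h_def inverse_limit_def split: nat.split)
  qed
  have hc: "continuous_on ?X h"
  proof (rule continuous_on_coordinatewise_then_product)
    fix i
    have "continuous_on ?X (\<lambda>z. f (z 0))"
      by (rule continuous_on_compose2[OF c continuous_on_coordinate]) (auto simp: inverse_limit_def)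
    then show "continuous_on ?X (\<lambda>z. h z i)"
      using continuous_on_coordinate by (cases i) (auto simp: h_def)
  qed
  have hi: "inj_on h ?X"
  proof (rule inj_onI)
    fix z w assume "h z = h w"
    then have "h z (Suc i) = h w (Suc i)" for i by simp
    then show "z = w" by (auto simp: h_def)
  qed
  define k where "k t = \<phi> (h (\<psi> t))" for t
  have kI: "k t \<in> ?I" if "t \<in> ?I" for t using \<phi>(1) hX \<psi>(1) that by (simp add: k_def)
  have "continuous_on ?I k"
    unfolding k_def
    by (rule continuous_on_compose2[OF \<phi>(3)], rule continuous_on_compose2[OF hc \<psi>(3)])
      (use hX \<psi>(1) in auto)
  moreover have "inj_on k ?I"
  proof (rule inj_onI)
    fix s t assume st: "s \<in> ?I" "t \<in> ?I" "k s = k t"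
    then have "\<psi> (\<phi> (h (\<psi> s))) = \<psi> (\<phi> (h (\<psi> t)))" by (simp only: k_def)
    then have "h (\<psi> s) = h (\<psi> t)"
      using \<phi>(2)[OF hX[OF \<psi>(1)[OF st(1)]]] \<phi>(2)[OF hX[OF \<psi>(1)[OF st(2)]]] by simp
    then have "\<psi> s = \<psi> t" using inj_onD[OF hi] \<psi>(1) st by blast
    then show "s = t" using \<psi>(2) st by metis
  qed
  ultimately have "strict_mono_on ?I k \<or> strict_antimono_on ?I k"
    using injective_eq_monotone_map[OF is_interval_cc] by blast
  then have mono: "strict_mono_on ?I (k \<circ> k)"
    using kI unfolding monotone_on_def o_def by (elim disjE) blast+
  define P where "P t = \<psi> t 0" for t
  have kk: "k (k t) = \<phi> (h (h (\<psi> t)))" if "t \<in> ?I" for t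
    using \<phi>(2)[OF hX[OF \<psi>(1)[OF that]]] by (simp add: k_def)
  have "monotone_extension (f \<circ> f) (k \<circ> k) P"
  proof
    show "interval_map (f \<circ> f)" by (rule interval_map_square[OF f])
    show "strict_mono_on ?I (k \<circ> k)" by (rule mono)
    show "(k \<circ> k) t \<in> ?I" if "t \<in> ?I" for t using kI that by simp
    show "continuous_on ?I P"
      unfolding P_def
      by (rule continuous_on_compose2[OF continuous_on_coordinate[of UNIV] \<psi>(3)]) simp
    show "P ` ?I = ?I"
    proof
      show "P ` ?I \<subseteq> ?I" using \<psi>(1) by (auto simp: P_def inverse_limit_def)
      show "?I \<subseteq> P ` ?I"
      proof
        fix x assume "x \<in> ?I"
        then obtain z where z: "z \<in> ?X" "z 0 = x" using extend_coordinate[OF f, of x 0] by blast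
        then have "P (\<phi> z) = x" using \<phi>(2) by (simp add: P_def)
        then show "x \<in> P ` ?I" using \<phi>(1)[OF z(1)] by blast
      qed
    qed
    show "P ((k \<circ> k) t) = (f \<circ> f) (P t)" if "t \<in> ?I" for t
      using kk[OF that] \<phi>(2)[OF hX[OF hX[OF \<psi>(1)[OF that]]]] by (simp add: P_def h_def)
    show "\<exists>t. \<forall>n. t n \<in> ?I \<and> (k \<circ> k) (t (Suc n)) = t n \<and> P (t n) = x n"
      if x: "\<And>n. x n \<in> ?I" "\<And>n. (f \<circ> f) (x (Suc n)) = x n" for x
    proof -
      \<comment> \<open>Even coordinates are prescribed, and the odd ones are their forced images under \<open>f\<close>; shifting \<open>z\<close> by \<open>2 n\<close> gives the lift.\<close>
      define z where "z i = (if even i then x (i div 2) else f (x (Suc (i div 2))))" for i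
      have fx: "f (x n) \<in> ?I" for n using x(1) o by blast
      have zX: "z \<in> ?X"
        using x fx by (auto simp: inverse_limit_def z_def)
      define w where "w n = (\<lambda>i. z (i + 2 * n))" for n
      have wX: "w n \<in> ?X" for n using zX by (auto simp: w_def inverse_limit_def)
      have hh: "h (h (w (Suc n))) = w n" for n
      proof
        fix i
        have "f (z (Suc j)) = z j" for j using zX by (simp add: inverse_limit_def)
        then show "h (h (w (Suc n))) i = w n i"
          by (auto simp: h_def w_def split: nat.split)
      qed
      have "(k \<circ> k) (\<phi> (w (Suc n))) = \<phi> (w n)" for n
        using kk[OF \<phi>(1)[OF wX]] \<phi>(2)[OF wX] by (simp add: hh)
      moreover have "P (\<phi> (w n)) = x n" for n
        using \<phi>(2)[OF wX] by (simp add: P_def w_def z_def)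
      ultimately show ?thesis using \<phi>(1)[OF wX] by (intro exI[of _ "\<lambda>n. \<phi> (w n)"]) simp
    qed
  qed
  then show ?thesis by blast
qed

section \<open>The characterization\<close>

theorem theoremB8:
  fixes f :: "real \<Rightarrow> real"
  assumes "interval_map f" and "piecewise_monotone f"
  shows "arc_space (inverse_limit f) \<longleftrightarrow>
    (\<forall>x\<in>{0..1}. \<exists>y\<in>fix_set (f \<circ> f). attracted_to (f \<circ> f) x y) \<and>
    (\<forall>C\<in>components ({0..1} - fix_set (f \<circ> f)).
       \<exists>y\<in>fix_set (f \<circ> f). \<forall>x\<in>C. attracted_to (f \<circ> f) x y)"
proof
  assume "arc_space (inverse_limit f)"
  then obtain H P where "monotone_extension (f \<circ> f) H P"
    using arc_monotone_extension[OF assms(1)] by blast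
  then interpret monotone_extension "f \<circ> f" H P .
  show "(\<forall>x\<in>{0..1}. \<exists>y\<in>fix_set (f \<circ> f). attracted_to (f \<circ> f) x y) \<and>
    (\<forall>C\<in>components ({0..1} - fix_set (f \<circ> f)).
       \<exists>y\<in>fix_set (f \<circ> f). \<forall>x\<in>C. attracted_to (f \<circ> f) x y)"
    using every_point_attracted component_same_limit by blast
next
  assume "(\<forall>x\<in>{0..1}. \<exists>y\<in>fix_set (f \<circ> f). attracted_to (f \<circ> f) x y) \<and>
    (\<forall>C\<in>components ({0..1} - fix_set (f \<circ> f)).
       \<exists>y\<in>fix_set (f \<circ> f). \<forall>x\<in>C. attracted_to (f \<circ> f) x y)"
  then interpret attracting_map "f \<circ> f"
    using attracting_square[OF assms] by blast
  show "arc_space (inverse_limit f)"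
    by (rule arc_inverse_limit[OF assms(1) refl])
qed

end
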